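(* Let $G$ be a group, $\mathcal{A}$ a unital $C^\ast$-algebra, $\tau$ an action of $G$ on $\mathcal{A}$ by unital $C^\ast$-automorphisms, and for $1\le i\le n$ let $\mathcal{H}_i$ be Hilbert spaces and $\phi_i\in\mathrm{UCP}^{G_\tau}(\mathcal{A},\mathcal{B}(\mathcal{H}_i))$ be pure. If $\phi_1,\dots,\phi_n$ are disjoint, then $\phi_1\oplus\cdots\oplus\phi_n$ (the map $a\mapsto\phi_1(a)\oplus\cdots\oplus\phi_n(a)$) is a $C^\ast$-extreme point of $\mathrm{UCP}^{G_\tau}(\mathcal{A},\mathcal{B}(\mathcal{H}))$, where $\mathcal{H}=\mathcal{H}_1\oplus\cdots\oplus\mathcal{H}_n$.
   Context: $\mathrm{UCP}^{G_\tau}(\mathcal{A},\mathcal{B}(\mathcal{H}))$ is the set of unital completely positive maps $\phi:\mathcal{A}\to\mathcal{B}(\mathcal{H})$ with $\phi(\tau_g(a))=\phi(a)$ for all $g\in G,a\in\mathcal{A}$. A completely positive map $\phi$ is pure if every completely positive $\theta$ with $\phi-\theta$ completely positive is a scalar multiple of $\phi$; then the representation $\pi$ in its minimal Stinespring representation $(\pi,V,\mathcal{K})$ (i.e. $\phi=V^\ast\pi(\cdot)V$, $\pi$ a unital $*$-representation on $\mathcal{K}$, $\{\pi(a)Vh\}$ total in $\mathcal{K}$) is irreducible. Pure maps $\phi_1,\dots,\phi_n$ with minimal Stinespring representations $(\pi_i,V_i,\mathcal{K}_i)$ are disjoint if $\pi_1,\dots,\pi_n$ are mutually unitarily nonequivalent.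 A $C^\ast$-convex combination is $\sum_iT_i^\ast\phi_i(\cdot)T_i$ with $\sum_iT_i^\ast T_i=\mathrm{Id}_\mathcal{H}$, proper if all $T_i$ are invertible. $\phi$ is a $C^\ast$-extreme point of $\mathrm{UCP}^{G_\tau}(\mathcal{A},\mathcal{B}(\mathcal{H}))$ if whenever $\phi$ is a proper $C^\ast$-convex combination of elements $\phi_i$ of this set, there exist unitaries $U_i$ on $\mathcal{H}$ with $\phi_i=U_i^\ast\phi(\cdot)U_i$ for all $i$. *)

theory Defs
  imports "HOL-Analysis.Analysis" "HOL-Algebra.Group"
begin

section \<open>Complex normed spaces, complex Hilbert spaces, unital C*-algebras\<close>

class complex_vector = real_vector +
  fixes scaleC :: "complex \<Rightarrow> 'a \<Rightarrow> 'a" (infixr "*\<^sub>C" 75)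
  assumes scaleC_add_right: "c *\<^sub>C (x + y) = c *\<^sub>C x + c *\<^sub>C y"
    and scaleC_add_left: "(c + d) *\<^sub>C x = c *\<^sub>C x + d *\<^sub>C x"
    and scaleC_scaleC: "c *\<^sub>C (d *\<^sub>C x) = (c * d) *\<^sub>C x"
    and scaleC_one: "1 *\<^sub>C x = x"
    and scaleR_scaleC: "scaleR r x = complex_of_real r *\<^sub>C x"

class complex_normed_vector = complex_vector + real_normed_vector +
  assumes norm_scaleC: "norm (c *\<^sub>C x) = cmod c * norm x"

text \<open>Complex Hilbert space: inner product linear in the second argument,
  conjugate linear in the first; the norm is induced by it; complete.\<close>
class chilbert = complex_normed_vector + complete_space +
  fixes cinner :: "'a \<Rightarrow> 'a \<Rightarrow> complex"
  assumes cinner_add_right: "cinner x (y + z) = cinner x y + cinner x z"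
    and cinner_scaleC_right: "cinner x (c *\<^sub>C y) = c * cinner x y"
    and cinner_commute: "cinner y x = cnj (cinner x y)"
    and cinner_nonneg: "0 \<le> Re (cinner x x)"
    and norm_cinner: "norm x = sqrt (Re (cinner x x))"

text \<open>Unital C*-algebra: complex Banach algebra with unit, involution and C*-identity.\<close>
class cstar_algebra = complex_normed_vector + real_normed_algebra_1 + complete_space +
  fixes invol :: "'a \<Rightarrow> 'a"
  assumes invol_invol: "invol (invol x) = x"
    and invol_add: "invol (x + y) = invol x + invol y"
    and invol_scaleC: "invol (c *\<^sub>C x) = cnj c *\<^sub>C invol x"
    and invol_mult: "invol (x * y) = invol y * invol x"
    and cstar_identity: "norm (invol x * x) = norm x ^ 2"
    and scaleC_mult_left: "(c *\<^sub>C x) * y = c *\<^sub>C (x * y)"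
    and scaleC_mult_right: "x * (c *\<^sub>C y) = c *\<^sub>C (x * y)"

section \<open>Subspaces, projections, operators\<close>

definition csubspace :: "'h::chilbert set \<Rightarrow> bool" where
  "csubspace S \<longleftrightarrow> 0 \<in> S \<and> (\<forall>x\<in>S. \<forall>y\<in>S. x + y \<in> S) \<and>
     (\<forall>c. \<forall>x\<in>S. c *\<^sub>C x \<in> S) \<and> closed S"

text \<open>Orthogonal projection onto a closed subspace.\<close>
definition proj :: "'h::chilbert set \<Rightarrow> 'h \<Rightarrow> 'h" where
  "proj S x = (THE y. y \<in> S \<and> (\<forall>z\<in>S. cinner z (x - y) = 0))"

definition bclinear :: "('a::complex_normed_vector \<Rightarrow> 'b::complex_normed_vector) \<Rightarrow> bool" where
  "bclinear T \<longleftrightarrow> (\<forall>x y. T (x + y) = T x + T y) \<and> (\<forall>c x. T (c *\<^sub>C x) = c *\<^sub>C T x) \<and>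
     (\<exists>K. \<forall>x. norm (T x) \<le> norm x * K)"

text \<open>A bounded operator from the subspace S to the subspace K, represented by a map on the
  ambient spaces which vanishes on the orthogonal complement of S and has range in K.\<close>
definition is_op :: "'h::chilbert set \<Rightarrow> 'k::chilbert set \<Rightarrow> ('h \<Rightarrow> 'k) \<Rightarrow> bool" where
  "is_op S K T \<longleftrightarrow> bclinear T \<and> T = proj K \<circ> T \<circ> proj S"

definition adj :: "('h::chilbert \<Rightarrow> 'k::chilbert) \<Rightarrow> 'k \<Rightarrow> 'h" where
  "adj T y = (THE x. \<forall>z. cinner x z = cinner y (T z))"

definition unitary_op :: "'h::chilbert set \<Rightarrow> ('h \<Rightarrow> 'h) \<Rightarrow> bool" where
  "unitary_op S U \<longleftrightarrow> is_op S S U \<and> adj U \<circ> U = proj S \<and> U \<circ> adj U = proj S"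

definition invertible_op :: "'h::chilbert set \<Rightarrow> ('h \<Rightarrow> 'h) \<Rightarrow> bool" where
  "invertible_op S T \<longleftrightarrow> is_op S S T \<and> (\<exists>R. is_op S S R \<and> R \<circ> T = proj S \<and> T \<circ> R = proj S)"

section \<open>Completely positive maps\<close>

text \<open>Positivity in M_n(A): of the form X* X.\<close>
definition positive_mat :: "nat \<Rightarrow> (nat \<Rightarrow> nat \<Rightarrow> 'a::cstar_algebra) \<Rightarrow> bool" where
  "positive_mat n M \<longleftrightarrow> (\<exists>X. \<forall>i<n. \<forall>j<n. M i j = (\<Sum>k<n. invol (X k i) * X k j))"

text \<open>Positivity of an n x n block operator matrix acting on H^n.\<close>
definition positive_block :: "nat \<Rightarrow> (nat \<Rightarrow> nat \<Rightarrow> 'h::chilbert \<Rightarrow> 'h) \<Rightarrow> bool" where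
  "positive_block n T \<longleftrightarrow> (\<forall>\<xi>. Im (\<Sum>i<n. \<Sum>j<n. cinner (\<xi> i) (T i j (\<xi> j))) = 0 \<and>
                                0 \<le> Re (\<Sum>i<n. \<Sum>j<n. cinner (\<xi> i) (T i j (\<xi> j))))"

definition cp_map :: "'h::chilbert set \<Rightarrow> ('a::cstar_algebra \<Rightarrow> 'h \<Rightarrow> 'h) \<Rightarrow> bool" where
  "cp_map S \<phi> \<longleftrightarrow> (\<forall>a. is_op S S (\<phi> a)) \<and>
     (\<forall>a b. \<phi> (a + b) = (\<lambda>x. \<phi> a x + \<phi> b x)) \<and> (\<forall>c a. \<phi> (c *\<^sub>C a) = (\<lambda>x. c *\<^sub>C \<phi> a x)) \<and>
     (\<forall>n M. positive_mat n M \<longrightarrow> positive_block n (\<lambda>i j. \<phi> (M i j)))"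

definition ucp_map :: "'h::chilbert set \<Rightarrow> ('a::cstar_algebra \<Rightarrow> 'h \<Rightarrow> 'h) \<Rightarrow> bool" where
  "ucp_map S \<phi> \<longleftrightarrow> cp_map S \<phi> \<and> \<phi> 1 = proj S"

definition pure_cp :: "'h::chilbert set \<Rightarrow> ('a::cstar_algebra \<Rightarrow> 'h \<Rightarrow> 'h) \<Rightarrow> bool" where
  "pure_cp S \<phi> \<longleftrightarrow> cp_map S \<phi> \<and>
     (\<forall>\<theta>. cp_map S \<theta> \<and> cp_map S (\<lambda>a x. \<phi> a x - \<theta> a x) \<longrightarrow>
        (\<exists>c::complex. \<forall>a. \<theta> a = (\<lambda>x. c *\<^sub>C \<phi> a x)))"

section \<open>Group actions by unital C*-automorphisms and invariant UCP maps\<close>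

definition cstar_aut :: "('a::cstar_algebra \<Rightarrow> 'a) \<Rightarrow> bool" where
  "cstar_aut f \<longleftrightarrow> bij f \<and> (\<forall>x y. f (x + y) = f x + f y) \<and> (\<forall>c x. f (c *\<^sub>C x) = c *\<^sub>C f x) \<and>
     (\<forall>x y. f (x * y) = f x * f y) \<and> (\<forall>x. f (invol x) = invol (f x)) \<and> f 1 = 1"

definition cstar_action :: "('g, 'b) monoid_scheme \<Rightarrow> ('g \<Rightarrow> 'a::cstar_algebra \<Rightarrow> 'a) \<Rightarrow> bool" where
  "cstar_action G \<tau> \<longleftrightarrow> (\<forall>g\<in>carrier G. cstar_aut (\<tau> g)) \<and>
     (\<forall>g\<in>carrier G. \<forall>h\<in>carrier G. \<tau> (g \<otimes>\<^bsub>G\<^esub> h) = \<tau> g \<circ> \<tau> h) \<and> \<tau> \<one>\<^bsub>G\<^esub> = id"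

text \<open>Membership in UCP^{G_tau}(A, B(S)).\<close>
definition ucp_inv :: "('g, 'b) monoid_scheme \<Rightarrow> ('g \<Rightarrow> 'a::cstar_algebra \<Rightarrow> 'a) \<Rightarrow>
    'h::chilbert set \<Rightarrow> ('a \<Rightarrow> 'h \<Rightarrow> 'h) \<Rightarrow> bool" where
  "ucp_inv G \<tau> S \<phi> \<longleftrightarrow> ucp_map S \<phi> \<and> (\<forall>g\<in>carrier G. \<forall>a. \<phi> (\<tau> g a) = \<phi> a)"

section \<open>Stinespring representations\<close>

definition star_rep :: "'k::chilbert set \<Rightarrow> ('a::cstar_algebra \<Rightarrow> 'k \<Rightarrow> 'k) \<Rightarrow> bool" where
  "star_rep K \<pi> \<longleftrightarrow> (\<forall>a. is_op K K (\<pi> a)) \<and>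
     (\<forall>a b. \<pi> (a + b) = (\<lambda>x. \<pi> a x + \<pi> b x)) \<and> (\<forall>c a. \<pi> (c *\<^sub>C a) = (\<lambda>x. c *\<^sub>C \<pi> a x)) \<and>
     (\<forall>a b. \<pi> (a * b) = \<pi> a \<circ> \<pi> b) \<and> (\<forall>a. \<pi> (invol a) = adj (\<pi> a)) \<and> \<pi> 1 = proj K"

text \<open>(pi, V, K) is a minimal Stinespring representation of phi : A -> B(S).
  The set of vectors pi(a)Vh is invariant under complex scalars, so its real span has
  the same closure as its complex span.\<close>
definition min_stinespring :: "'h::chilbert set \<Rightarrow> ('a::cstar_algebra \<Rightarrow> 'h \<Rightarrow> 'h) \<Rightarrow>
    'k::chilbert set \<Rightarrow> ('a \<Rightarrow> 'k \<Rightarrow> 'k) \<Rightarrow> ('h \<Rightarrow> 'k) \<Rightarrow> bool" where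
  "min_stinespring S \<phi> K \<pi> V \<longleftrightarrow> csubspace K \<and> star_rep K \<pi> \<and> is_op S K V \<and>
     (\<forall>a. \<phi> a = adj V \<circ> \<pi> a \<circ> V) \<and>
     closure (span (\<Union>a. (\<lambda>h. \<pi> a (V h)) ` S)) = K"

definition unitarily_equiv :: "'k::chilbert set \<Rightarrow> ('a::cstar_algebra \<Rightarrow> 'k \<Rightarrow> 'k) \<Rightarrow>
    'k set \<Rightarrow> ('a \<Rightarrow> 'k \<Rightarrow> 'k) \<Rightarrow> bool" where
  "unitarily_equiv K1 \<pi>1 K2 \<pi>2 \<longleftrightarrow> (\<exists>W. is_op K1 K2 W \<and> adj W \<circ> W = proj K1 \<and>
     W \<circ> adj W = proj K2 \<and> (\<forall>a. W \<circ> \<pi>1 a = \<pi>2 a \<circ> W))"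

section \<open>C*-extreme points\<close>

definition cstar_extreme :: "('g, 'b) monoid_scheme \<Rightarrow> ('g \<Rightarrow> 'a::cstar_algebra \<Rightarrow> 'a) \<Rightarrow>
    'h::chilbert set \<Rightarrow> ('a \<Rightarrow> 'h \<Rightarrow> 'h) \<Rightarrow> bool" where
  "cstar_extreme G \<tau> S \<phi> \<longleftrightarrow> ucp_inv G \<tau> S \<phi> \<and>
     (\<forall>(m::nat) (T::nat \<Rightarrow> 'h \<Rightarrow> 'h) (\<psi>::nat \<Rightarrow> 'a \<Rightarrow> 'h \<Rightarrow> 'h). (\<forall>j<m. ucp_inv G \<tau> S (\<psi> j) \<and> invertible_op S (T j)) \<and>
        (\<lambda>x. \<Sum>j<m. adj (T j) (T j x)) = proj S \<and>
        (\<forall>a. \<phi> a = (\<lambda>x. \<Sum>j<m. adj (T j) (\<psi> j a (T j x))))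
      \<longrightarrow> (\<exists>U::nat \<Rightarrow> 'h \<Rightarrow> 'h. \<forall>j<m. unitary_op S (U j) \<and> (\<forall>a. \<psi> j a = adj (U j) \<circ> \<phi> a \<circ> U j)))"

end

theory Submission
  imports Defs
begin

text \<open>Let \<Phi> = \<phi> 1 \<oplus> ... \<oplus> \<phi> n and suppose \<Phi> = \<Sum>j. (T j)* \<psi> j (T j) with invertible T j.
  Each \<theta> j = (T j)* \<psi> j (-) (T j) is completely positive and so is \<Phi> - \<theta> j. Compressed to a
  block H i, \<theta> j lies below the pure map \<phi> i and is therefore a scalar multiple of it. A
  compression from H i to H k with i \<noteq> k is bounded, by the Cauchy-Schwarz inequality for the
  positive form of \<theta> j on formal sums \<Sum> a \<otimes> h, by the norms in the Stinespring spaces of \<phi> k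
  and \<phi> i. It therefore defines an intertwiner between these irreducible, inequivalent
  representations, which vanishes by Schur's lemma. Hence (T j)* \<psi> j (T j) = D \<Phi> D for a
  positive diagonal D, and D (T j)\<inverse> is a unitary conjugating \<Phi> into \<psi> j.\<close>

section \<open>Complex inner product spaces\<close>

declare scaleC_one [simp] scaleC_scaleC [simp]

lemma scaleC_zero_left [simp]: "(0::complex) *\<^sub>C (x::'v::complex_vector) = 0"
proof -
  have "(0::complex) *\<^sub>C x = 0 *\<^sub>C x + 0 *\<^sub>C x"
    using scaleC_add_left[of 0 0 x] by simp
  then show ?thesis by simp
qed

lemma scaleC_zero_right [simp]: "c *\<^sub>C (0::'v::complex_vector) = 0"
proof -
  have "c *\<^sub>C (0::'v) = c *\<^sub>C 0 + c *\<^sub>C 0"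
    using scaleC_add_right[of c 0 0] by simp
  then show ?thesis by simp
qed

lemma scaleC_minus_right: "c *\<^sub>C (- (x::'v::complex_vector)) = - (c *\<^sub>C x)"
  by (metis add_eq_0_iff2 neg_eq_iff_add_eq_0 scaleC_add_right scaleC_zero_right)

lemma scaleC_minus_left: "(- c) *\<^sub>C (x::'v::complex_vector) = - (c *\<^sub>C x)"
  by (metis add.right_inverse eq_neg_iff_add_eq_0 scaleC_add_left scaleC_zero_left)

lemma scaleC_diff_right: "c *\<^sub>C ((x::'v::complex_vector) - y) = c *\<^sub>C x - c *\<^sub>C y"
  by (simp only: diff_conv_add_uminus scaleC_add_right scaleC_minus_right)

lemma scaleC_diff_left: "(c - d) *\<^sub>C (x::'v::complex_vector) = c *\<^sub>C x - d *\<^sub>C x"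
  by (simp only: diff_conv_add_uminus scaleC_add_left scaleC_minus_left)

lemma scaleC_sum_right: "c *\<^sub>C (\<Sum>i\<in>A. f i) = (\<Sum>i\<in>A. c *\<^sub>C (f i::'v::complex_vector))"
  by (induction A rule: infinite_finite_induct) (auto simp: scaleC_add_right)

lemma scaleC_eq_0_iff: "c *\<^sub>C (x::'v::complex_vector) = 0 \<longleftrightarrow> c = 0 \<or> x = 0"
proof
  assume cx: "c *\<^sub>C x = 0"
  show "c = 0 \<or> x = 0"
  proof (cases "c = 0")
    case False
    then have "x = inverse c *\<^sub>C (c *\<^sub>C x)" by simp
    then show ?thesis using cx by simp
  qed simp
qed auto

lemma cinner_cnj: "cnj (cinner x (y::'h::chilbert)) = cinner y x"
  using cinner_commute[of y x] by simp

lemma cinner_add_left: "cinner (x + y) (z::'h::chilbert) = cinner x z + cinner y z"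
proof -
  have "cinner (x + y) z = cnj (cinner z x) + cnj (cinner z y)"
    by (simp add: cinner_commute[of "x + y"] cinner_add_right)
  then show ?thesis by (simp add: cinner_cnj)
qed

lemma cinner_scaleC_left: "cinner (c *\<^sub>C x) (y::'h::chilbert) = cnj c * cinner x y"
proof -
  have "cinner (c *\<^sub>C x) y = cnj c * cnj (cinner y x)"
    by (simp add: cinner_commute[of "c *\<^sub>C x"] cinner_scaleC_right)
  then show ?thesis by (simp add: cinner_cnj)
qed

lemma cinner_zero_left [simp]: "cinner 0 (y::'h::chilbert) = 0"
  using cinner_add_left[of 0 0 y] by simp

lemma cinner_zero_right [simp]: "cinner y (0::'h::chilbert) = 0"
  using cinner_add_right[of y 0 0] by simp

lemma cinner_minus_left: "cinner (- x) (y::'h::chilbert) = - cinner x y"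
  by (metis add.right_inverse add_eq_0_iff2 cinner_add_left cinner_zero_left)

lemma cinner_minus_right: "cinner y (- x::'h::chilbert) = - cinner y x"
  by (metis add.right_inverse add_eq_0_iff2 cinner_add_right cinner_zero_right)

lemma cinner_diff_left: "cinner (x - y) (z::'h::chilbert) = cinner x z - cinner y z"
  by (simp only: diff_conv_add_uminus cinner_add_left cinner_minus_left)

lemma cinner_diff_right: "cinner z (x - y::'h::chilbert) = cinner z x - cinner z y"
  by (simp only: diff_conv_add_uminus cinner_add_right cinner_minus_right)

lemma cinner_sum_left: "cinner (\<Sum>i\<in>A. f i) (y::'h::chilbert) = (\<Sum>i\<in>A. cinner (f i) y)"
  by (induction A rule: infinite_finite_induct) (auto simp: cinner_add_left)

lemma cinner_sum_right: "cinner y (\<Sum>i\<in>A. f i::'h::chilbert) = (\<Sum>i\<in>A. cinner y (f i))"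
  by (induction A rule: infinite_finite_induct) (auto simp: cinner_add_right)

lemmas cinner_simps = cinner_add_left cinner_add_right cinner_scaleC_left cinner_scaleC_right
  cinner_diff_left cinner_diff_right cinner_minus_left cinner_minus_right cinner_sum_left cinner_sum_right

lemma cinner_self_norm: "cinner x (x::'h::chilbert) = complex_of_real ((norm x)\<^sup>2)"
proof -
  have "Im (cinner x x) = Im (cnj (cinner x x))"
    using cinner_commute[of x x] by simp
  then have "Im (cinner x x) = 0" by simp
  moreover have "Re (cinner x x) = (norm x)\<^sup>2"
    using norm_cinner[of x] cinner_nonneg[of x] by simp
  ultimately show ?thesis by (simp add: complex_eq_iff)
qed

lemma cinner_self_eq_0 [simp]: "cinner x x = 0 \<longleftrightarrow> x = (0::'h::chilbert)"
  by (simp add: cinner_self_norm)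

lemma norm_sq_add: "(norm (x + y::'h::chilbert))\<^sup>2 = (norm x)\<^sup>2 + (norm y)\<^sup>2 + 2 * Re (cinner x y)"
proof -
  have "(norm (x + y))\<^sup>2 = Re (cinner (x + y) (x + y))"
    by (simp add: cinner_self_norm)
  also have "\<dots> = Re (cinner x x) + Re (cinner y y) + Re (cinner x y) + Re (cinner y x)"
    by (simp add: cinner_simps)
  also have "Re (cinner y x) = Re (cinner x y)"
    using cinner_commute[of y x] by simp
  finally show ?thesis by (simp add: cinner_self_norm)
qed

lemma cinner_eq_0_imp_eq_0: "(\<And>z. cinner z x = 0) \<Longrightarrow> x = (0::'h::chilbert)"
  using cinner_self_eq_0 by blast

lemma cinner_left_cancel: "(\<And>z. cinner x z = cinner y z) \<Longrightarrow> x = (y::'h::chilbert)"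
  using cinner_eq_0_imp_eq_0[of "x - y"]
  by (metis cinner_cnj cinner_diff_right cinner_diff_left right_minus_eq)

lemma norm_sq_diff_proj_line:
  fixes z w :: "'h::chilbert"
  assumes "z \<noteq> 0"
  shows "(norm (w - (cinner z w / cinner z z) *\<^sub>C z))\<^sup>2 = (norm w)\<^sup>2 - (cmod (cinner z w))\<^sup>2 / (norm z)\<^sup>2"
proof -
  define t where "t = cinner z w / cinner z z"
  have zz: "cinner z z = complex_of_real ((norm z)\<^sup>2)" by (rule cinner_self_norm)
  have "cinner (w - t *\<^sub>C z) (w - t *\<^sub>C z)
      = cinner w w - t * cinner w z - cnj t * cinner z w + cnj t * t * cinner z z"
    by (simp only: cinner_diff_left cinner_diff_right cinner_scaleC_left cinner_scaleC_right)
      (simp add: algebra_simps)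
  also have "cnj t * t * cinner z z = cnj t * cinner z w"
    using assms by (simp add: t_def)
  also have "t * cinner w z = complex_of_real ((cmod (cinner z w))\<^sup>2 / (norm z)\<^sup>2)"
  proof -
    have "cinner z w * cinner w z = cinner z w * cnj (cinner z w)"
      by (simp add: cinner_commute[of w z])
    also have "\<dots> = complex_of_real ((cmod (cinner z w))\<^sup>2)"
      by (rule complex_norm_square[symmetric])
    finally show ?thesis unfolding t_def zz by simp
  qed
  finally have "complex_of_real ((norm (w - t *\<^sub>C z))\<^sup>2)
      = complex_of_real ((norm w)\<^sup>2) - complex_of_real ((cmod (cinner z w))\<^sup>2 / (norm z)\<^sup>2)"
    by (simp only: cinner_self_norm add_diff_cancel_right' diff_add_cancel)
  then show ?thesis unfolding t_def by (simp only: of_real_diff[symmetric] of_real_eq_iff)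
qed

lemma Cauchy_Schwarz: "cmod (cinner x y) \<le> norm x * norm (y::'h::chilbert)"
proof (cases "y = 0")
  case False
  have "0 \<le> (norm (x - (cinner y x / cinner y y) *\<^sub>C y))\<^sup>2" by simp
  then have "(cmod (cinner y x))\<^sup>2 / (norm y)\<^sup>2 \<le> (norm x)\<^sup>2"
    using norm_sq_diff_proj_line[OF False, of x] by simp
  then have "(cmod (cinner y x))\<^sup>2 \<le> (norm x * norm y)\<^sup>2"
    using False by (simp add: field_simps power_mult_distrib)
  moreover have "cmod (cinner y x) = cmod (cinner x y)"
    by (simp add: cinner_commute[of y x])
  ultimately show ?thesis by (metis norm_ge_zero mult_nonneg_nonneg power2_le_imp_le)
qed simp

lemma bounded_linear_cinner_right: "bounded_linear (cinner (w::'h::chilbert))"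
proof (rule bounded_linear_intro[of _ "norm w"])
  show "cinner w (r *\<^sub>R x) = r *\<^sub>R cinner w x" for r x
    by (simp add: scaleR_scaleC cinner_scaleC_right scaleR_conv_of_real)
  show "norm (cinner w x) \<le> norm x * norm w" for x
    using Cauchy_Schwarz[of w x] by (simp add: mult.commute)
qed (rule cinner_add_right)

lemma continuous_on_cinner_right: "continuous_on A (cinner (w::'h::chilbert))"
  using bounded_linear_cinner_right linear_continuous_on by blast

lemma continuous_on_cinner_left: "continuous_on A (\<lambda>x. cinner x (w::'h::chilbert))"
proof -
  have "continuous_on A (\<lambda>x. cnj (cinner w x))"
    by (intro continuous_on_cnj continuous_on_cinner_right)
  then show ?thesis by (simp add: cinner_cnj)
qed

section \<open>Subspaces, bounded maps and orthogonal projections\<close>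

lemma csubspace_0: "csubspace M \<Longrightarrow> 0 \<in> M" unfolding csubspace_def by blast
lemma csubspace_add: "csubspace M \<Longrightarrow> x \<in> M \<Longrightarrow> y \<in> M \<Longrightarrow> x + y \<in> M" unfolding csubspace_def by blast
lemma csubspace_scaleC: "csubspace M \<Longrightarrow> x \<in> M \<Longrightarrow> c *\<^sub>C x \<in> M" unfolding csubspace_def by blast
lemma csubspace_closed: "csubspace M \<Longrightarrow> closed M" unfolding csubspace_def by blast
lemma csubspace_minus: "csubspace M \<Longrightarrow> x \<in> M \<Longrightarrow> - x \<in> M"
  using csubspace_scaleC[of M x "-1"] by (simp add: scaleC_minus_left)
lemma csubspace_diff: "csubspace M \<Longrightarrow> x \<in> M \<Longrightarrow> y \<in> M \<Longrightarrow> x - y \<in> M"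
  using csubspace_add[of M x "-y"] csubspace_minus[of M y] by simp
lemma csubspace_scaleR: "csubspace M \<Longrightarrow> x \<in> M \<Longrightarrow> r *\<^sub>R x \<in> M"
  by (simp add: scaleR_scaleC csubspace_scaleC)
lemma csubspace_sum: "csubspace M \<Longrightarrow> (\<And>i. i \<in> A \<Longrightarrow> f i \<in> M) \<Longrightarrow> sum f A \<in> M"
  by (induction A rule: infinite_finite_induct) (auto simp: csubspace_0 csubspace_add)

definition alg_csubspace :: "'v::complex_vector set \<Rightarrow> bool" where
  "alg_csubspace D \<longleftrightarrow> 0 \<in> D \<and> (\<forall>x\<in>D. \<forall>y\<in>D. x + y \<in> D) \<and> (\<forall>c. \<forall>x\<in>D. c *\<^sub>C x \<in> D)"

lemma alg_csubspaceI:
  "0 \<in> D \<Longrightarrow> (\<And>x y. x \<in> D \<Longrightarrow> y \<in> D \<Longrightarrow> x + y \<in> D) \<Longrightarrow> (\<And>c x. x \<in> D \<Longrightarrow> c *\<^sub>C x \<in> D) \<Longrightarrow> alg_csubspace D"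
  unfolding alg_csubspace_def by blast

lemma alg_csubspace_0: "alg_csubspace D \<Longrightarrow> 0 \<in> D"
  and alg_csubspace_add: "alg_csubspace D \<Longrightarrow> x \<in> D \<Longrightarrow> y \<in> D \<Longrightarrow> x + y \<in> D"
  and alg_csubspace_scaleC: "alg_csubspace D \<Longrightarrow> x \<in> D \<Longrightarrow> c *\<^sub>C x \<in> D"
  unfolding alg_csubspace_def by blast+

lemma bclinear_add: "bclinear T \<Longrightarrow> T (x + y) = T x + T y" unfolding bclinear_def by blast
lemma bclinear_scaleC: "bclinear T \<Longrightarrow> T (c *\<^sub>C x) = c *\<^sub>C T x" unfolding bclinear_def by blast

lemma bclinear_bounded: "bclinear T \<Longrightarrow> \<exists>K>0. \<forall>x. norm (T x) \<le> norm x * K"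
proof -
  assume "bclinear T"
  then obtain K where K: "\<forall>x. norm (T x) \<le> norm x * K" unfolding bclinear_def by blast
  have "norm (T x) \<le> norm x * max K 1" for x
    using K[rule_format, of x] by (meson max.cobounded1 mult_left_mono norm_ge_zero order_trans)
  then show ?thesis by (intro exI[of _ "max K 1"]) auto
qed

lemma bclinear_bounded_linear: "bclinear T \<Longrightarrow> bounded_linear T"
proof -
  assume T: "bclinear T"
  then obtain K where K: "\<forall>x. norm (T x) \<le> norm x * K" unfolding bclinear_def by blast
  show ?thesis
  proof (rule bounded_linear_intro[of _ K])
    show "T (x + y) = T x + T y" for x y using T by (rule bclinear_add)
    show "T (r *\<^sub>R x) = r *\<^sub>R T x" for r x using bclinear_scaleC[OF T] by (simp add: scaleR_scaleC)
    show "norm (T x) \<le> norm x * K" for x using K by blast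
  qed
qed

lemma bclinear_zero: "bclinear T \<Longrightarrow> T 0 = 0"
  using bclinear_bounded_linear[THEN bounded_linear.linear] linear_0 by blast
lemma bclinear_diff: "bclinear T \<Longrightarrow> T (x - y) = T x - T y"
  using bclinear_bounded_linear[THEN bounded_linear.linear] linear_diff by blast
lemma bclinear_sum: "bclinear T \<Longrightarrow> T (sum f A) = (\<Sum>i\<in>A. T (f i))"
  using bclinear_bounded_linear[THEN bounded_linear.linear] linear_sum by blast
lemma bclinear_continuous: "bclinear T \<Longrightarrow> continuous_on A T"
  using bclinear_bounded_linear linear_continuous_on by blast

lemma bclinear_intro:
  assumes "\<And>x y. T (x + y) = T x + T y" "\<And>c x. T (c *\<^sub>C x) = c *\<^sub>C T x" "\<And>x. norm (T x) \<le> norm x * K"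
  shows "bclinear T"
  unfolding bclinear_def using assms by blast

lemma bclinear_comp: "bclinear A \<Longrightarrow> bclinear B \<Longrightarrow> bclinear (A \<circ> B)"
proof -
  assume A: "bclinear A" and B: "bclinear B"
  obtain KA where KA: "KA > 0" "\<forall>x. norm (A x) \<le> norm x * KA" using bclinear_bounded[OF A] by blast
  obtain KB where KB: "KB > 0" "\<forall>x. norm (B x) \<le> norm x * KB" using bclinear_bounded[OF B] by blast
  show ?thesis
  proof (rule bclinear_intro[of _ "KB * KA"])
    show "(A \<circ> B) (x + y) = (A \<circ> B) x + (A \<circ> B) y" for x y by (simp add: bclinear_add A B)
    show "(A \<circ> B) (c *\<^sub>C x) = c *\<^sub>C (A \<circ> B) x" for c x by (simp add: bclinear_scaleC A B)
    show "norm ((A \<circ> B) x) \<le> norm x * (KB * KA)" for x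
    proof -
      have "norm (A (B x)) \<le> norm (B x) * KA" using KA by blast
      also have "\<dots> \<le> (norm x * KB) * KA" using KB KA(1) by (intro mult_right_mono) auto
      finally show ?thesis by (simp add: mult.assoc)
    qed
  qed
qed

lemma bclinear_comp': "bclinear A \<Longrightarrow> bclinear B \<Longrightarrow> bclinear (\<lambda>x. A (B x))"
  using bclinear_comp[of A B] by (simp add: comp_def)

lemma bclinear_id: "bclinear (\<lambda>x. x)"
  by (rule bclinear_intro[of _ 1]) auto

lemma bclinear_zero_fun: "bclinear (\<lambda>x. 0)"
  by (rule bclinear_intro[of _ 1]) auto

lemma bclinear_add_fun: "bclinear A \<Longrightarrow> bclinear B \<Longrightarrow> bclinear (\<lambda>x. A x + B x)"
proof -
  assume A: "bclinear A" and B: "bclinear B"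
  obtain KA where KA: "KA > 0" "\<forall>x. norm (A x) \<le> norm x * KA" using bclinear_bounded[OF A] by blast
  obtain KB where KB: "KB > 0" "\<forall>x. norm (B x) \<le> norm x * KB" using bclinear_bounded[OF B] by blast
  show ?thesis
  proof (rule bclinear_intro[of _ "KA + KB"])
    show "A (x + y) + B (x + y) = A x + B x + (A y + B y)" for x y by (simp add: bclinear_add A B algebra_simps)
    show "A (c *\<^sub>C x) + B (c *\<^sub>C x) = c *\<^sub>C (A x + B x)" for c x by (simp add: bclinear_scaleC A B scaleC_add_right)
    show "norm (A x + B x) \<le> norm x * (KA + KB)" for x
    proof -
      have "norm (A x + B x) \<le> norm (A x) + norm (B x)" by (rule norm_triangle_ineq)
      also have "\<dots> \<le> norm x * KA + norm x * KB" using KA KB by (intro add_mono) auto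
      finally show ?thesis by (simp add: algebra_simps)
    qed
  qed
qed

lemma bclinear_scaleC_fun: "bclinear A \<Longrightarrow> bclinear (\<lambda>x. c *\<^sub>C A x)"
proof -
  assume A: "bclinear A"
  obtain KA where KA: "KA > 0" "\<forall>x. norm (A x) \<le> norm x * KA" using bclinear_bounded[OF A] by blast
  show ?thesis
  proof (rule bclinear_intro[of _ "cmod c * KA"])
    show "c *\<^sub>C A (x + y) = c *\<^sub>C A x + c *\<^sub>C A y" for x y by (simp add: bclinear_add A scaleC_add_right)
    show "c *\<^sub>C A (d *\<^sub>C x) = d *\<^sub>C (c *\<^sub>C A x)" for d x by (simp add: bclinear_scaleC A mult.commute)
    show "norm (c *\<^sub>C A x) \<le> norm x * (cmod c * KA)" for x
      using KA(2)[rule_format, of x] by (simp add: norm_scaleC) (metis mult.left_commute mult_left_mono norm_ge_zero)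
  qed
qed

lemma bclinear_diff_fun: "bclinear A \<Longrightarrow> bclinear B \<Longrightarrow> bclinear (\<lambda>x. A x - B x)"
proof -
  assume A: "bclinear A" and B: "bclinear B"
  have "bclinear (\<lambda>x. A x + (-1) *\<^sub>C B x)" by (intro bclinear_add_fun bclinear_scaleC_fun A B)
  then show ?thesis by (simp add: scaleC_minus_left)
qed

lemma bclinear_sum_fun: "(\<And>i. i \<in> I \<Longrightarrow> bclinear (T i)) \<Longrightarrow> bclinear (\<lambda>x. \<Sum>i\<in>I. T i x)"
proof (induction I rule: infinite_finite_induct)
  case (infinite A) then show ?case by (simp add: bclinear_zero_fun)
next
  case empty then show ?case by (simp add: bclinear_zero_fun)
next
  case (insert i F)
  then show ?case by (simp add: bclinear_add_fun)
qed

lemma infdist_approx: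
  assumes "A \<noteq> {}" "e > 0" shows "\<exists>a\<in>A. dist x a < infdist x A + e"
proof (rule ccontr)
  assume "\<not> ?thesis"
  then have "\<forall>a\<in>A. infdist x A + e \<le> dist x a" by (auto simp: not_less)
  then have "infdist x A + e \<le> infdist x A" unfolding infdist_notempty[OF assms(1)]
    by (intro cINF_greatest assms(1)) auto
  then show False using assms(2) by simp
qed

lemma midpoint_parallelogram_bound:
  fixes x y z :: "'h::chilbert"
  assumes mid: "d \<le> norm (x - (1/2::real) *\<^sub>R (y + z))"
    and y: "norm (x - y) \<le> d + e" and z: "norm (x - z) \<le> d + e'"
    and d: "0 \<le> d" and e: "0 \<le> e" "e \<le> 1" and e': "0 \<le> e'" "e' \<le> 1"
  shows "(norm (y - z))\<^sup>2 \<le> 4 * (d + 1) * (e + e')"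
proof -
  define u where "u = x - y"
  define v where "v = x - z"
  have "u + v = (x + x) - (y + z)" unfolding u_def v_def by (simp add: algebra_simps)
  then have "x - (1/2::real) *\<^sub>R (y + z) = (1/2::real) *\<^sub>R (u + v)"
    by (simp add: scaleR_diff_right)
  then have "2 * d \<le> norm (u + v)" using mid by simp
  then have d2: "(2 * d)\<^sup>2 \<le> (norm (u + v))\<^sup>2" using d by (intro power_mono) auto
  have "(norm (u + v))\<^sup>2 + (norm (u - v))\<^sup>2 = 2 * (norm u)\<^sup>2 + 2 * (norm v)\<^sup>2"
    using norm_sq_add[of u v] norm_sq_add[of u "- v"] by (simp add: cinner_minus_right)
  moreover have "(norm (u - v))\<^sup>2 = (norm (y - z))\<^sup>2"
    unfolding u_def v_def by (simp add: norm_minus_commute)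
  moreover have "(norm u)\<^sup>2 \<le> (d + e)\<^sup>2" "(norm v)\<^sup>2 \<le> (d + e')\<^sup>2"
    using y z unfolding u_def v_def by (auto intro: power_mono)
  ultimately have "(norm (y - z))\<^sup>2 \<le> 2 * (d + e)\<^sup>2 + 2 * (d + e')\<^sup>2 - (2 * d)\<^sup>2"
    using d2 by linarith
  also have "\<dots> = 4 * d * e + 4 * d * e' + 2 * (e * e) + 2 * (e' * e')"
    by (simp add: power2_eq_square algebra_simps)
  also have "\<dots> \<le> 4 * (d + 1) * (e + e')"
    using e e' d mult_left_le_one_le[of e e] mult_left_le_one_le[of e' e'] by (simp add: algebra_simps)
  finally show ?thesis .
qed

lemma minimizing_sequence_Cauchy:
  fixes x :: "'h::chilbert"
  assumes M: "csubspace M" and d0: "0 \<le> d" and dle: "\<And>a. a \<in> M \<Longrightarrow> d \<le> norm (x - a)"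
    and y: "\<And>n. y n \<in> M" "\<And>n. norm (x - y n) \<le> d + 1 / real (Suc n)"
  shows "Cauchy y"
proof (rule metric_CauchyI)
  fix e :: real assume e: "0 < e"
  obtain N :: nat where N: "8 * (d + 1) / e\<^sup>2 < real N" using reals_Archimedean2 by blast
  have "dist (y m) (y n) < e" if "m \<ge> N" "n \<ge> N" for m n
  proof -
    have mid: "d \<le> norm (x - (1/2::real) *\<^sub>R (y m + y n))"
      by (rule dle) (use M y in \<open>simp add: csubspace_add csubspace_scaleR\<close>)
    have "(norm (y m - y n))\<^sup>2 \<le> 4 * (d + 1) * (1 / real (Suc m) + 1 / real (Suc n))"
      by (rule midpoint_parallelogram_bound[OF mid y(2) y(2) d0]) auto
    also have "\<dots> \<le> 4 * (d + 1) * (2 / real (Suc N))"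
    proof -
      have "1 / real (Suc m) \<le> 1 / real (Suc N)" "1 / real (Suc n) \<le> 1 / real (Suc N)"
        using that by (auto simp: field_simps)
      then show ?thesis using d0 by (intro mult_left_mono) auto
    qed
    also have "\<dots> < e\<^sup>2"
    proof -
      have "8 * (d + 1) < e\<^sup>2 * real N" using N e by (simp add: field_simps)
      also have "\<dots> \<le> e\<^sup>2 * real (Suc N)" using e by (intro mult_left_mono) auto
      finally show ?thesis by (simp add: field_simps)
    qed
    finally show ?thesis using e by (simp add: dist_norm power_less_imp_less_base)
  qed
  then show "\<exists>N. \<forall>m\<ge>N. \<forall>n\<ge>N. dist (y m) (y n) < e" by blast
qed

lemma csubspace_dist_minimizer:
  fixes x :: "'h::chilbert"
  assumes M: "csubspace M"
  shows "\<exists>l\<in>M. \<forall>a\<in>M. norm (x - l) \<le> norm (x - a)"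
proof -
  define d where "d = infdist x M"
  have d0: "0 \<le> d" unfolding d_def by (rule infdist_nonneg)
  have dle: "d \<le> norm (x - a)" if "a \<in> M" for a
    using infdist_le[OF that, of x] by (simp add: d_def dist_norm)
  have "\<exists>a\<in>M. dist x a < d + 1 / real (Suc n)" for n
    using infdist_approx[of M "1 / real (Suc n)" x] csubspace_0[OF M] by (auto simp: d_def)
  then have "\<exists>y. \<forall>n. y n \<in> M \<and> dist x (y n) < d + 1 / real (Suc n)" by (intro choice) blast
  then obtain y where y: "\<And>n. y n \<in> M" "\<And>n. norm (x - y n) \<le> d + 1 / real (Suc n)"
    by (auto simp: dist_norm intro: less_imp_le)
  obtain l where l: "y \<longlonglongrightarrow> l"
    using minimizing_sequence_Cauchy[OF M d0 dle y] Cauchy_convergent_iff convergent_def by blast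
  have "l \<in> M" using closed_sequentially[OF csubspace_closed[OF M]] y(1) l by blast
  moreover have "norm (x - l) \<le> d"
  proof (rule LIMSEQ_le)
    show "(\<lambda>n. norm (x - y n)) \<longlonglongrightarrow> norm (x - l)" using l by (intro tendsto_intros)
    have "(\<lambda>n. 1 / real (Suc n)) \<longlonglongrightarrow> 0"
      using LIMSEQ_inverse_real_of_nat by (simp add: inverse_eq_divide)
    then show "(\<lambda>n. d + 1 / real (Suc n)) \<longlonglongrightarrow> d"
      using tendsto_add[OF tendsto_const[of d]] by fastforce
  qed (use y(2) in auto)
  ultimately show ?thesis using dle by force
qed

lemma proj_exists:
  fixes x :: "'h::chilbert"
  assumes M: "csubspace M"
  shows "\<exists>y\<in>M. \<forall>z\<in>M. cinner z (x - y) = 0"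
proof -
  obtain l where lM: "l \<in> M" and lmin: "\<And>a. a \<in> M \<Longrightarrow> norm (x - l) \<le> norm (x - a)"
    using csubspace_dist_minimizer[OF M] by blast
  have "cinner z (x - l) = 0" if zM: "z \<in> M" and z0: "z \<noteq> 0" for z
  proof -
    define w where "w = x - l"
    define t where "t = cinner z w / cinner z z"
    have "l + t *\<^sub>C z \<in> M" using M lM zM by (simp add: csubspace_add csubspace_scaleC)
    then have "norm w \<le> norm (w - t *\<^sub>C z)"
      using lmin unfolding w_def by (metis diff_diff_add)
    then have "(norm w)\<^sup>2 \<le> (norm (w - t *\<^sub>C z))\<^sup>2" by (simp add: power_mono)
    also have "\<dots> = (norm w)\<^sup>2 - (cmod (cinner z w))\<^sup>2 / (norm z)\<^sup>2"
      unfolding t_def by (rule norm_sq_diff_proj_line[OF z0])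
    finally have "(cmod (cinner z w))\<^sup>2 \<le> 0" using z0 by (simp add: divide_le_0_iff)
    then show ?thesis unfolding w_def by simp
  qed
  then show ?thesis using lM by (metis cinner_zero_left)
qed

lemma proj_unique:
  fixes x :: "'h::chilbert"
  assumes "y \<in> M" "y' \<in> M" "\<forall>z\<in>M. cinner z (x - y) = 0" "\<forall>z\<in>M. cinner z (x - y') = 0"
  shows "y = y'"
proof -
  have "cinner y (y' - y) = 0" "cinner y' (y' - y) = 0"
  proof -
    have "y' - y = (x - y) - (x - y')" by simp
    then show "cinner y (y' - y) = 0" "cinner y' (y' - y) = 0"
      using assms by (simp_all add: cinner_diff_right)
  qed
  then have "cinner (y' - y) (y' - y) = 0" by (simp add: cinner_diff_left)
  then show ?thesis by simp
qed

lemma proj_eqI: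
  fixes x :: "'h::chilbert"
  assumes "y \<in> M" "\<forall>z\<in>M. cinner z (x - y) = 0"
  shows "proj M x = y"
  unfolding proj_def
proof (rule the_equality)
  show "y \<in> M \<and> (\<forall>z\<in>M. cinner z (x - y) = 0)" using assms by simp
  fix y' assume "y' \<in> M \<and> (\<forall>z\<in>M. cinner z (x - y') = 0)"
  then show "y' = y" using proj_unique[of y' M y x] assms by simp
qed

lemma proj_char: "csubspace M \<Longrightarrow> proj M x \<in> M \<and> (\<forall>z\<in>M. cinner z (x - proj M x) = 0)"
proof -
  assume M: "csubspace M"
  obtain y where y: "y \<in> M" "\<forall>z\<in>M. cinner z (x - y) = 0" using proj_exists[OF M, of x] by blast
  have "proj M x = y" using y by (rule proj_eqI)
  then show ?thesis using y by simp
qed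

lemma proj_in: "csubspace M \<Longrightarrow> proj M x \<in> M"
  using proj_char by blast

lemma proj_orth: "csubspace M \<Longrightarrow> z \<in> M \<Longrightarrow> cinner z (x - proj M x) = 0"
  using proj_char by blast

lemma proj_orth': "csubspace M \<Longrightarrow> z \<in> M \<Longrightarrow> cinner z x = cinner z (proj M x)"
  using proj_orth[of M z x] by (simp add: cinner_diff_right)

lemma proj_id: "x \<in> M \<Longrightarrow> proj M x = x"
  by (rule proj_eqI) auto

lemma proj_orth_zero: "0 \<in> M \<Longrightarrow> (\<forall>z\<in>M. cinner z x = 0) \<Longrightarrow> proj M x = 0"
  by (rule proj_eqI) auto

lemma proj_add: "csubspace M \<Longrightarrow> proj M (x + y) = proj M x + proj M y"
  by (rule proj_eqI) (auto simp: csubspace_add proj_in cinner_diff_right cinner_add_right proj_orth'[of M _ x] proj_orth'[of M _ y])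

lemma proj_scaleC: "csubspace M \<Longrightarrow> proj M (c *\<^sub>C x) = c *\<^sub>C proj M x"
proof (rule proj_eqI)
  assume M: "csubspace M"
  show "c *\<^sub>C proj M x \<in> M" using M by (simp add: csubspace_scaleC proj_in)
  show "\<forall>z\<in>M. cinner z (c *\<^sub>C x - c *\<^sub>C proj M x) = 0"
    using proj_orth[OF M] by (simp add: scaleC_diff_right[symmetric] cinner_scaleC_right)
qed

lemma proj_idem: "csubspace M \<Longrightarrow> proj M (proj M x) = proj M x"
  by (simp add: proj_id proj_in)

lemma proj_cinner_left: "csubspace M \<Longrightarrow> cinner (proj M x) y = cinner (proj M x) (proj M y)"
proof -
  assume M: "csubspace M"
  have "cinner (proj M x) (y - proj M y) = 0" using proj_orth[OF M proj_in[OF M]] .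
  then show ?thesis by (simp add: cinner_diff_right)
qed

lemma proj_selfadj: "csubspace M \<Longrightarrow> cinner (proj M x) y = cinner x (proj M y)"
proof -
  assume M: "csubspace M"
  have "cinner x (proj M y) = cnj (cinner (proj M y) x)" by (rule cinner_commute)
  also have "\<dots> = cnj (cinner (proj M y) (proj M x))" using proj_cinner_left[OF M, of y x] by simp
  also have "\<dots> = cinner (proj M x) (proj M y)" by (simp add: cinner_cnj)
  also have "\<dots> = cinner (proj M x) y" using proj_cinner_left[OF M, of x y] by simp
  finally show ?thesis by simp
qed

lemma proj_norm: "csubspace M \<Longrightarrow> norm (proj M x) \<le> norm x"
proof -
  assume M: "csubspace M"
  have "(norm x)\<^sup>2 = (norm (proj M x + (x - proj M x)))\<^sup>2" by simp
  also have "\<dots> = (norm (proj M x))\<^sup>2 + (norm (x - proj M x))\<^sup>2 + 2 * Re (cinner (proj M x) (x - proj M x))"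
    by (rule norm_sq_add)
  finally have e: "(norm x)\<^sup>2 = (norm (proj M x))\<^sup>2 + (norm (x - proj M x))\<^sup>2 + 2 * Re (cinner (proj M x) (x - proj M x))" .
  have "cinner (proj M x) (x - proj M x) = 0" using proj_orth[OF M proj_in[OF M]] .
  then have "(norm (proj M x))\<^sup>2 \<le> (norm x)\<^sup>2" using e by simp
  then show ?thesis by (rule power2_le_imp_le) simp
qed

lemma bclinear_proj: "csubspace M \<Longrightarrow> bclinear (proj M)"
proof -
  assume M: "csubspace M"
  show ?thesis
  proof (rule bclinear_intro[of _ 1])
    show "proj M (x + y) = proj M x + proj M y" for x y by (rule proj_add[OF M])
    show "proj M (c *\<^sub>C x) = c *\<^sub>C proj M x" for c x by (rule proj_scaleC[OF M])
    show "norm (proj M x) \<le> norm x * 1" for x using proj_norm[OF M] by simp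
  qed
qed

section \<open>Density, Riesz representation and adjoints\<close>

lemma dense_eq:
  fixes f g :: "'a::topological_space \<Rightarrow> 'b::t2_space"
  assumes "continuous_on UNIV f" "continuous_on UNIV g" "\<And>y. y \<in> D \<Longrightarrow> f y = g y" "x \<in> closure D"
  shows "f x = g x"
proof -
  have "closure D \<subseteq> {x. f x = g x}"
    by (rule closure_minimal) (use assms closed_Collect_eq[OF assms(1,2)] in auto)
  then show ?thesis using assms(4) by blast
qed

lemma dense_orth:
  fixes w :: "'h::chilbert"
  assumes "\<And>y. y \<in> D \<Longrightarrow> cinner w y = 0" "w \<in> closure D"
  shows "w = 0"
proof -
  have "cinner w w = 0"
    using dense_eq[of "cinner w" "\<lambda>_. 0" D w] assms continuous_on_cinner_right by auto
  then show ?thesis by simp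
qed

lemma closure_csubspace:
  fixes D :: "'h::chilbert set"
  assumes D: "alg_csubspace D"
  shows "csubspace (closure D)"
proof -
  have add1: "x + y \<in> closure D" if "x \<in> closure D" "y \<in> D" for x y
  proof -
    have "(\<lambda>x. x + y) ` closure D \<subseteq> closure D"
      by (rule image_closure_subset)
        (auto intro!: continuous_intros alg_csubspace_add[OF D] that closure_subset[THEN subsetD])
    then show ?thesis using that by blast
  qed
  have add2: "x + y \<in> closure D" if "x \<in> closure D" "y \<in> closure D" for x y
  proof -
    have "(\<lambda>y. x + y) ` closure D \<subseteq> closure D"
      by (rule image_closure_subset) (auto intro!: continuous_intros add1[OF that(1)])
    then show ?thesis using that by blast
  qed
  have sc: "c *\<^sub>C x \<in> closure D" if "x \<in> closure D" for c x
  proof -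
    have "(\<lambda>x. c *\<^sub>C x) ` closure D \<subseteq> closure D"
    proof (rule image_closure_subset)
      show "continuous_on (closure D) (\<lambda>x. c *\<^sub>C x)"
        using bclinear_continuous bclinear_scaleC_fun[OF bclinear_id] by blast
    qed (auto intro: alg_csubspace_scaleC[OF D] closure_subset[THEN subsetD])
    then show ?thesis using that by blast
  qed
  show ?thesis
    unfolding csubspace_def using alg_csubspace_0[OF D] closure_subset add2 sc by blast
qed

lemma bounded_functional_kernel_closure:
  fixes f :: "'h::real_normed_vector \<Rightarrow> complex"
  assumes y: "y \<in> D" "f y = 1"
    and diff: "\<And>x. x \<in> D \<Longrightarrow> y - x \<in> D \<and> f (y - x) = f y - f x"
    and bound: "\<And>x. x \<in> D \<Longrightarrow> cmod (f x) \<le> C * norm x"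
  shows "y \<notin> closure {x\<in>D. f x = 0}"
proof
  assume "y \<in> closure {x\<in>D. f x = 0}"
  moreover have "1 / (\<bar>C\<bar> + 1) > 0" by simp
  ultimately obtain x where x: "x \<in> D" "f x = 0" and "dist x y < 1 / (\<bar>C\<bar> + 1)"
    unfolding closure_approachable by blast
  then have "(\<bar>C\<bar> + 1) * norm (y - x) < 1"
    by (simp add: dist_norm norm_minus_commute field_simps)
  moreover have "1 \<le> C * norm (y - x)"
    using bound[of "y - x"] diff[OF x(1)] x(2) y(2) by simp
  moreover have "C * norm (y - x) \<le> (\<bar>C\<bar> + 1) * norm (y - x)"
    by (simp add: mult_right_mono)
  ultimately show False by linarith
qed

text \<open>The representing vector is taken orthogonal to the closure of the kernel.\<close>

lemma riesz_dense:
  fixes D :: "'h::chilbert set" and f :: "'h \<Rightarrow> complex"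
  assumes D: "alg_csubspace D"
    and fadd: "\<And>x y. x\<in>D \<Longrightarrow> y\<in>D \<Longrightarrow> f (x + y) = f x + f y"
    and fsc: "\<And>c x. x\<in>D \<Longrightarrow> f (c *\<^sub>C x) = c * f x"
    and fb: "\<And>x. x\<in>D \<Longrightarrow> cmod (f x) \<le> C * norm x"
  shows "\<exists>z\<in>closure D. \<forall>y\<in>D. f y = cinner z y"
proof (cases "\<forall>y\<in>D. f y = 0")
  case True
  then show ?thesis using alg_csubspace_0[OF D] closure_subset by (intro bexI[of _ 0]) auto
next
  case False
  then obtain y0 where y0: "y0 \<in> D" "f y0 \<noteq> 0" by blast
  define y1 where "y1 = (1 / f y0) *\<^sub>C y0"
  have y1D: "y1 \<in> D" unfolding y1_def using y0 alg_csubspace_scaleC[OF D] by blast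
  have fy1: "f y1 = 1" unfolding y1_def using y0 fsc by simp
  have comb: "x + c *\<^sub>C y \<in> D \<and> f (x + c *\<^sub>C y) = f x + c * f y" if "x \<in> D" "y \<in> D" for x y c
    using that fadd fsc alg_csubspace_add[OF D] alg_csubspace_scaleC[OF D] by simp
  define N where "N = {y\<in>D. f y = 0}"
  have cN: "csubspace (closure N)"
    using comb[of _ _ 1] comb[of 0 _] alg_csubspace_0[OF D] fsc[of 0 0]
    by (intro closure_csubspace alg_csubspaceI) (auto simp: N_def)
  have cD: "csubspace (closure D)" by (rule closure_csubspace[OF D])
  define p where "p = proj (closure N) y1"
  define u where "u = y1 - p"
  have pN: "p \<in> closure N" unfolding p_def using proj_in[OF cN] .
  have uorth: "cinner u m = 0" if "m \<in> closure N" for m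
    using proj_orth[OF cN that, of y1] cinner_cnj[of m u] unfolding u_def p_def by simp
  have "y1 \<notin> closure N"
    unfolding N_def
  proof (rule bounded_functional_kernel_closure[OF y1D fy1 _ fb])
    show "y1 - x \<in> D \<and> f (y1 - x) = f y1 - f x" if "x \<in> D" for x
      using comb[OF y1D that, of "-1"] by (simp add: scaleC_minus_left)
  qed
  then have u0: "u \<noteq> 0" using pN by (auto simp: u_def)
  have key: "cinner u y = f y * cinner u y1" if yD: "y \<in> D" for y
  proof -
    have "y + (- f y) *\<^sub>C y1 \<in> N" using comb[OF yD y1D] fy1 by (simp add: N_def)
    then have "cinner u (y + (- f y) *\<^sub>C y1) = 0" using uorth closure_subset by blast
    then show ?thesis by (simp add: cinner_add_right cinner_scaleC_right)
  qed
  have uy1: "cinner u y1 = cinner u u"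
    using uorth[OF pN] by (simp add: u_def cinner_diff_right)
  have uu: "cnj (cinner u u) = cinner u u" by (simp add: cinner_self_norm)
  define z where "z = (1 / cinner u u) *\<^sub>C u"
  have "u \<in> closure D"
    using cD y1D pN closure_mono[of N D] closure_subset unfolding u_def
    by (auto simp: N_def intro: csubspace_diff)
  then have "z \<in> closure D" unfolding z_def using cD csubspace_scaleC by blast
  moreover have "f y = cinner z y" if "y \<in> D" for y
    using key[OF that] uy1 u0 uu by (simp add: z_def cinner_scaleC_left)
  ultimately show ?thesis by blast
qed

lemma adj_exists:
  fixes T :: "'h::chilbert \<Rightarrow> 'k::chilbert"
  assumes T: "bclinear T"
  shows "\<exists>x. \<forall>z. cinner x z = cinner y (T z)"
proof -
  obtain K where K: "K > 0" "\<forall>x. norm (T x) \<le> norm x * K" using bclinear_bounded[OF T] by blast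
  have "\<exists>x\<in>closure UNIV. \<forall>z\<in>UNIV. cinner y (T z) = cinner x z"
  proof (rule riesz_dense[where C = "norm y * K"])
    show "cinner y (T (x + z)) = cinner y (T x) + cinner y (T z)" for x z by (simp add: bclinear_add[OF T] cinner_add_right)
    show "cinner y (T (c *\<^sub>C x)) = c * cinner y (T x)" for c x by (simp add: bclinear_scaleC[OF T] cinner_scaleC_right)
    show "cmod (cinner y (T x)) \<le> norm y * K * norm x" for x
    proof -
      have "cmod (cinner y (T x)) \<le> norm y * norm (T x)" by (rule Cauchy_Schwarz)
      also have "\<dots> \<le> norm y * (norm x * K)" using K by (intro mult_left_mono) auto
      finally show ?thesis by (simp add: algebra_simps)
    qed
  qed (auto simp: alg_csubspace_def)
  then show ?thesis by auto
qed

lemma adj_cinner: "bclinear T \<Longrightarrow> cinner (adj T y) z = cinner y (T z)"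
proof -
  assume T: "bclinear T"
  obtain x where x: "\<forall>z. cinner x z = cinner y (T z)" using adj_exists[OF T] by blast
  have "adj T y = x" unfolding adj_def
  proof (rule the_equality)
    show "\<forall>z. cinner x z = cinner y (T z)" by (rule x)
    fix x' assume "\<forall>z. cinner x' z = cinner y (T z)"
    then show "x' = x" using x by (intro cinner_left_cancel) simp
  qed
  then show ?thesis using x by simp
qed

lemma adj_cinner_right: "bclinear T \<Longrightarrow> cinner z (adj T y) = cinner (T z) y"
proof -
  assume T: "bclinear T"
  have "cinner z (adj T y) = cnj (cinner (adj T y) z)" by (rule cinner_commute)
  also have "\<dots> = cnj (cinner y (T z))" by (simp add: adj_cinner[OF T])
  also have "\<dots> = cinner (T z) y" by (rule cinner_cnj)
  finally show ?thesis .
qed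

lemma adj_eqI: "(\<And>y z. cinner (A y) z = cinner y (T z)) \<Longrightarrow> adj T = A"
proof (rule ext)
  fix y assume h: "\<And>y z. cinner (A y) z = cinner y (T z)"
  show "adj T y = A y" unfolding adj_def
  proof (rule the_equality)
    show "\<forall>z. cinner (A y) z = cinner y (T z)" using h by blast
    fix x' assume "\<forall>z. cinner x' z = cinner y (T z)"
    then show "x' = A y" using h by (intro cinner_left_cancel) simp
  qed
qed

lemma bclinear_adj: "bclinear T \<Longrightarrow> bclinear (adj T)"
proof -
  assume T: "bclinear T"
  obtain K where K: "K > 0" "\<forall>x. norm (T x) \<le> norm x * K" using bclinear_bounded[OF T] by blast
  show ?thesis
  proof (rule bclinear_intro[of _ K])
    show "adj T (x + y) = adj T x + adj T y" for x y
      by (rule cinner_left_cancel) (simp add: adj_cinner[OF T] cinner_add_left)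
    show "adj T (c *\<^sub>C x) = c *\<^sub>C adj T x" for c x
      by (rule cinner_left_cancel) (simp add: adj_cinner[OF T] cinner_scaleC_left)
    show "norm (adj T y) \<le> norm y * K" for y
    proof -
      have "(norm (adj T y))\<^sup>2 = Re (cinner (adj T y) (adj T y))" by (simp add: cinner_self_norm)
      also have "\<dots> = Re (cinner y (T (adj T y)))" by (simp add: adj_cinner[OF T])
      also have "\<dots> \<le> cmod (cinner y (T (adj T y)))" by (rule complex_Re_le_cmod)
      also have "\<dots> \<le> norm y * norm (T (adj T y))" by (rule Cauchy_Schwarz)
      also have "\<dots> \<le> norm y * (norm (adj T y) * K)" using K by (intro mult_left_mono) auto
      finally have *: "(norm (adj T y))\<^sup>2 \<le> (norm y * K) * norm (adj T y)" by (simp add: algebra_simps)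
      show ?thesis
      proof (cases "norm (adj T y) = 0")
        case True then show ?thesis using K by simp
      next
        case False
        then have "norm (adj T y) > 0" by simp
        then show ?thesis using * by (simp add: power2_eq_square)
      qed
    qed
  qed
qed

lemma adj_adj: "bclinear T \<Longrightarrow> adj (adj T) = T"
  by (rule adj_eqI) (simp add: adj_cinner_right)

lemma adj_comp: "bclinear A \<Longrightarrow> bclinear B \<Longrightarrow> adj (A \<circ> B) = adj B \<circ> adj A"
  by (rule adj_eqI) (simp add: adj_cinner)

lemma adj_comp': "bclinear A \<Longrightarrow> bclinear B \<Longrightarrow> adj (\<lambda>x. A (B x)) = (\<lambda>y. adj B (adj A y))"
  by (rule adj_eqI) (simp add: adj_cinner)

lemma adj_proj: "csubspace M \<Longrightarrow> adj (proj M) = proj M"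
  by (rule adj_eqI) (simp add: proj_selfadj)

lemma adj_scaleC_fun: "bclinear A \<Longrightarrow> adj (\<lambda>x. c *\<^sub>C A x) = (\<lambda>y. cnj c *\<^sub>C adj A y)"
  by (rule adj_eqI) (simp add: adj_cinner cinner_scaleC_left cinner_scaleC_right)

lemma is_op_bclinear: "is_op S K T \<Longrightarrow> bclinear T" unfolding is_op_def by blast

lemma is_op_range: "is_op S K T \<Longrightarrow> csubspace K \<Longrightarrow> T x \<in> K"
  unfolding is_op_def by (metis comp_apply proj_in)

lemma is_op_left: "is_op S K T \<Longrightarrow> csubspace K \<Longrightarrow> proj K (T x) = T x"
  by (simp add: is_op_range proj_id)

lemma is_op_right: "is_op S K T \<Longrightarrow> csubspace S \<Longrightarrow> T (proj S x) = T x"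
proof -
  assume T: "is_op S K T" and S: "csubspace S"
  have "T = proj K \<circ> T \<circ> proj S" using T unfolding is_op_def by blast
  then have "T (proj S x) = proj K (T (proj S (proj S x)))" "T x = proj K (T (proj S x))"
    by (metis comp_apply)+
  then show ?thesis by (simp add: proj_idem[OF S])
qed

lemma is_opI:
  assumes "bclinear T" "csubspace K" "\<And>x. T x \<in> K" "\<And>x. T (proj S x) = T x"
  shows "is_op S K T"
  unfolding is_op_def using assms by (auto simp: fun_eq_iff proj_id)

lemma is_op_adj:
  assumes T: "is_op S K T" and S: "csubspace S" and K: "csubspace K"
  shows "is_op K S (adj T)"
proof -
  have Tb: "bclinear T" using T by (rule is_op_bclinear)
  have "T = proj K \<circ> T \<circ> proj S" using T unfolding is_op_def by blast
  then have "adj T = adj (proj K \<circ> T \<circ> proj S)" by simp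
  also have "\<dots> = proj S \<circ> adj T \<circ> proj K"
    by (simp add: adj_comp bclinear_comp bclinear_proj S K Tb adj_proj comp_assoc)
  finally show ?thesis unfolding is_op_def using bclinear_adj[OF Tb] by blast
qed

lemma adj_range:
  assumes B: "bclinear B" and BK: "\<And>x. B (proj K x) = B x" and K: "csubspace K"
  shows "adj B y \<in> K"
proof -
  have "B = B \<circ> proj K" using BK by (simp add: fun_eq_iff)
  then have "adj B = proj K \<circ> adj B" by (metis adj_comp B bclinear_proj K adj_proj)
  then show ?thesis by (metis comp_apply proj_in K)
qed

lemma is_op_comp:
  assumes A: "is_op K L A" and B: "is_op S K B" and S: "csubspace S" and L: "csubspace L"
  shows "is_op S L (A \<circ> B)"
  by (rule is_opI) (auto simp: bclinear_comp is_op_bclinear[OF A] is_op_bclinear[OF B] L is_op_range[OF A L] is_op_right[OF B S])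

lemma is_op_comp':
  assumes A: "is_op K L A" and B: "is_op S K B" and S: "csubspace S" and L: "csubspace L"
  shows "is_op S L (\<lambda>x. A (B x))"
  using is_op_comp[OF assms] by (simp add: comp_def)


section \<open>Representations and completely positive maps\<close>

lemma invol_one [simp]: "invol (1::'a::cstar_algebra) = 1"
  by (metis invol_invol invol_mult mult_1_left mult_1_right)

context
  fixes K :: "'k::chilbert set" and \<pi> :: "'a::cstar_algebra \<Rightarrow> 'k \<Rightarrow> 'k"
  assumes rep: "star_rep K \<pi>" and K: "csubspace K"
begin

lemma rep_op: "is_op K K (\<pi> a)" using rep unfolding star_rep_def by blast
lemma rep_bclinear: "bclinear (\<pi> a)" using rep_op is_op_bclinear by blast
lemma rep_add: "\<pi> (a + b) x = \<pi> a x + \<pi> b x" using rep unfolding star_rep_def by metis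
lemma rep_scaleC: "\<pi> (c *\<^sub>C a) x = c *\<^sub>C \<pi> a x" using rep unfolding star_rep_def by metis
lemma rep_mult: "\<pi> (a * b) x = \<pi> a (\<pi> b x)" using rep unfolding star_rep_def by (metis comp_apply)
lemma rep_invol: "\<pi> (invol a) = adj (\<pi> a)" using rep unfolding star_rep_def by blast

lemma rep_sum: "\<pi> (\<Sum>i\<in>A. f i) x = (\<Sum>i\<in>A. \<pi> (f i) x)"
proof (induct A rule: infinite_finite_induct)
  case (infinite A)
  have "\<pi> 0 x = \<pi> 0 x + \<pi> 0 x" using rep_add[of 0 0 x] by simp
  then show ?case using infinite by simp
next
  case empty
  have "\<pi> 0 x = \<pi> 0 x + \<pi> 0 x" using rep_add[of 0 0 x] by simp
  then show ?case by simp
qed (simp add: rep_add)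

lemma rep_range: "\<pi> a x \<in> K" using is_op_range[OF rep_op K] .
lemma rep_proj: "\<pi> a (proj K x) = \<pi> a x" using is_op_right[OF rep_op K] .

lemma cinner_rep_left: "cinner (\<pi> a x) y = cinner x (\<pi> (invol a) y)"
  by (simp add: rep_invol adj_cinner_right[OF rep_bclinear])

lemma cinner_rep_right: "cinner x (\<pi> a y) = cinner (\<pi> (invol a) x) y"
  using cinner_rep_left[of "invol a" x y] by (simp add: invol_invol)

end

lemma min_stinespring_csubspace: "min_stinespring H \<phi> K \<pi> V \<Longrightarrow> csubspace K"
  and min_stinespring_rep: "min_stinespring H \<phi> K \<pi> V \<Longrightarrow> star_rep K \<pi>"
  and min_stinespring_op: "min_stinespring H \<phi> K \<pi> V \<Longrightarrow> is_op H K V"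
  and min_stinespring_dense:
    "min_stinespring H \<phi> K \<pi> V \<Longrightarrow> closure (span (\<Union>a. (\<lambda>h. \<pi> a (V h)) ` H)) = K"
  unfolding min_stinespring_def by blast+

lemma min_stinespring_apply: "min_stinespring H \<phi> K \<pi> V \<Longrightarrow> \<phi> a x = adj V (\<pi> a (V x))"
  unfolding min_stinespring_def by (metis comp_apply)

lemma cp_map_op: "cp_map S T \<Longrightarrow> is_op S S (T a)"
  and cp_map_add: "cp_map S T \<Longrightarrow> T (a + b) x = T a x + T b x"
  and cp_map_scaleC: "cp_map S T \<Longrightarrow> T (c *\<^sub>C a) x = c *\<^sub>C T a x"
  and cp_map_positive_block: "cp_map S T \<Longrightarrow> positive_mat n M \<Longrightarrow> positive_block n (\<lambda>i j. T (M i j))"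
  unfolding cp_map_def by metis+

lemma cp_map_bclinear: "cp_map S T \<Longrightarrow> bclinear (T a)"
  using cp_map_op is_op_bclinear by blast

lemma cp_mapI:
  assumes "\<And>a. is_op S S (T a)" "\<And>a b x. T (a + b) x = T a x + T b x" "\<And>c a x. T (c *\<^sub>C a) x = c *\<^sub>C T a x"
    "\<And>n M. positive_mat n M \<Longrightarrow> positive_block n (\<lambda>i j. T (M i j))"
  shows "cp_map S T"
  unfolding cp_map_def using assms by (auto simp: fun_eq_iff)

lemma sum_swap3: "(\<Sum>i\<in>A. \<Sum>j\<in>B. \<Sum>l\<in>C. F i j l) = (\<Sum>l\<in>C. \<Sum>i\<in>A. \<Sum>j\<in>B. F i j l)"
proof -
  have "(\<Sum>i\<in>A. \<Sum>j\<in>B. \<Sum>l\<in>C. F i j l) = (\<Sum>i\<in>A. \<Sum>l\<in>C. \<Sum>j\<in>B. F i j l)"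
    by (rule sum.cong[OF refl], rule sum.swap)
  also have "\<dots> = (\<Sum>l\<in>C. \<Sum>i\<in>A. \<Sum>j\<in>B. F i j l)" by (rule sum.swap)
  finally show ?thesis .
qed

lemma positive_block_sum:
  fixes T :: "'l \<Rightarrow> nat \<Rightarrow> nat \<Rightarrow> 'h::chilbert \<Rightarrow> 'h"
  assumes "\<And>l. l \<in> I \<Longrightarrow> positive_block n (T l)"
  shows "positive_block n (\<lambda>i j x. \<Sum>l\<in>I. T l i j x)"
  unfolding positive_block_def
proof
  fix \<xi> :: "nat \<Rightarrow> 'h"
  have eq: "(\<Sum>i<n. \<Sum>j<n. cinner (\<xi> i) (\<Sum>l\<in>I. T l i j (\<xi> j)))
      = (\<Sum>l\<in>I. \<Sum>i<n. \<Sum>j<n. cinner (\<xi> i) (T l i j (\<xi> j)))"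
    unfolding cinner_sum_right by (rule sum_swap3)
  have "Im (\<Sum>i<n. \<Sum>j<n. cinner (\<xi> i) (T l i j (\<xi> j))) = 0 \<and>
      0 \<le> Re (\<Sum>i<n. \<Sum>j<n. cinner (\<xi> i) (T l i j (\<xi> j)))" if "l \<in> I" for l
    using assms[OF that] unfolding positive_block_def by blast
  then show "Im (\<Sum>i<n. \<Sum>j<n. cinner (\<xi> i) (\<Sum>l\<in>I. T l i j (\<xi> j))) = 0 \<and>
      0 \<le> Re (\<Sum>i<n. \<Sum>j<n. cinner (\<xi> i) (\<Sum>l\<in>I. T l i j (\<xi> j)))"
    unfolding eq Im_sum Re_sum by (auto intro: sum_nonneg)
qed

lemma cp_map_sum:
  fixes \<theta> :: "'l \<Rightarrow> 'a::cstar_algebra \<Rightarrow> 'h::chilbert \<Rightarrow> 'h"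
  assumes S: "csubspace S" and cp: "\<And>l. l \<in> I \<Longrightarrow> cp_map S (\<theta> l)"
  shows "cp_map S (\<lambda>a x. \<Sum>l\<in>I. \<theta> l a x)"
proof (rule cp_mapI)
  show "is_op S S (\<lambda>x. \<Sum>l\<in>I. \<theta> l a x)" for a
  proof (rule is_opI[OF _ S])
    show "bclinear (\<lambda>x. \<Sum>l\<in>I. \<theta> l a x)" by (rule bclinear_sum_fun) (rule cp_map_bclinear[OF cp])
    show "(\<Sum>l\<in>I. \<theta> l a x) \<in> S" for x
      by (rule csubspace_sum[OF S]) (rule is_op_range[OF cp_map_op[OF cp] S])
    show "(\<Sum>l\<in>I. \<theta> l a (proj S x)) = (\<Sum>l\<in>I. \<theta> l a x)" for x
      by (rule sum.cong[OF refl]) (rule is_op_right[OF cp_map_op[OF cp] S])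
  qed
  show "(\<Sum>l\<in>I. \<theta> l (a + b) x) = (\<Sum>l\<in>I. \<theta> l a x) + (\<Sum>l\<in>I. \<theta> l b x)" for a b x
    by (simp add: cp_map_add[OF cp] sum.distrib)
  show "(\<Sum>l\<in>I. \<theta> l (c *\<^sub>C a) x) = c *\<^sub>C (\<Sum>l\<in>I. \<theta> l a x)" for c a x
    by (simp add: cp_map_scaleC[OF cp] scaleC_sum_right)
  show "positive_block n (\<lambda>i j x. \<Sum>l\<in>I. \<theta> l (M i j) x)" if "positive_mat n M" for n M
    by (rule positive_block_sum) (rule cp_map_positive_block[OF cp that])
qed

lemma cp_map_conj:
  fixes \<psi> :: "'a::cstar_algebra \<Rightarrow> 'h::chilbert \<Rightarrow> 'h"
  assumes M: "csubspace M" and cp: "cp_map S \<psi>" and T: "bclinear T" and TM: "\<And>x. T (proj M x) = T x"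
  shows "cp_map M (\<lambda>a x. adj T (\<psi> a (T x)))"
proof (rule cp_mapI)
  have adjT: "bclinear (adj T)" using T by (rule bclinear_adj)
  show "is_op M M (\<lambda>x. adj T (\<psi> a (T x)))" for a
    by (rule is_opI[OF bclinear_comp'[OF adjT bclinear_comp'[OF cp_map_bclinear[OF cp] T]] M])
      (auto intro: adj_range[OF T TM M] simp: TM)
  show "adj T (\<psi> (a + b) (T x)) = adj T (\<psi> a (T x)) + adj T (\<psi> b (T x))" for a b x
    by (simp add: cp_map_add[OF cp] bclinear_add[OF adjT])
  show "adj T (\<psi> (c *\<^sub>C a) (T x)) = c *\<^sub>C adj T (\<psi> a (T x))" for c a x
    by (simp add: cp_map_scaleC[OF cp] bclinear_scaleC[OF adjT])
  show "positive_block n (\<lambda>i j x. adj T (\<psi> (N i j) (T x)))" if N: "positive_mat n N" for n N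
    using cp_map_positive_block[OF cp N] unfolding positive_block_def
    by (simp add: adj_cinner_right[OF T])
qed

lemma cp_map_compress:
  assumes "cp_map S \<theta>" and M: "csubspace M"
  shows "cp_map M (\<lambda>a x. proj M (\<theta> a (proj M x)))"
  using cp_map_conj[OF M assms(1) bclinear_proj[OF M]] by (simp add: adj_proj[OF M] proj_idem[OF M])

lemma cp_map_stinespring_commutant:
  fixes \<pi> :: "'a::cstar_algebra \<Rightarrow> 'k::chilbert \<Rightarrow> 'k" and V :: "'h::chilbert \<Rightarrow> 'k"
  assumes H: "csubspace H" and K: "csubspace K" and rep: "star_rep K \<pi>" and V: "is_op H K V"
    and E: "is_op K K E" and comm: "\<And>a x. E (\<pi> a x) = \<pi> a (E x)"
    and Epos: "\<And>\<eta>. \<eta> \<in> K \<Longrightarrow> Im (cinner \<eta> (E \<eta>)) = 0 \<and> 0 \<le> Re (cinner \<eta> (E \<eta>))"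
  shows "cp_map H (\<lambda>a x. adj V (\<pi> a (E (V x))))"
proof (rule cp_mapI)
  have Vb: "bclinear V" using V by (rule is_op_bclinear)
  have adjb: "bclinear (adj V)" using Vb by (rule bclinear_adj)
  have Eb: "bclinear E" using E by (rule is_op_bclinear)
  show "is_op H H (\<lambda>x. adj V (\<pi> a (E (V x))))" for a
    by (rule is_op_comp'[OF is_op_adj[OF V H K] is_op_comp'[OF rep_op[OF rep K] is_op_comp'[OF E V H K] H K] H H])
  show "adj V (\<pi> (a + b) (E (V x))) = adj V (\<pi> a (E (V x))) + adj V (\<pi> b (E (V x)))" for a b x
    by (simp add: rep_add[OF rep K] bclinear_add[OF adjb])
  show "adj V (\<pi> (c *\<^sub>C a) (E (V x))) = c *\<^sub>C adj V (\<pi> a (E (V x)))" for c a x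
    by (simp add: rep_scaleC[OF rep K] bclinear_scaleC[OF adjb])
  show "positive_block n (\<lambda>i j x. adj V (\<pi> (M i j) (E (V x))))" if "positive_mat n M" for n M
    unfolding positive_block_def
  proof
    fix \<xi> :: "nat \<Rightarrow> 'h"
    obtain X where X: "\<forall>i<n. \<forall>j<n. M i j = (\<Sum>k<n. invol (X k i) * X k j)"
      using \<open>positive_mat n M\<close> unfolding positive_mat_def by blast
    define \<eta> where "\<eta> k = (\<Sum>j<n. \<pi> (X k j) (V (\<xi> j)))" for k
    have "cinner (\<xi> i) (adj V (\<pi> (M i j) (E (V (\<xi> j)))))
        = (\<Sum>k<n. cinner (\<pi> (X k i) (V (\<xi> i))) (E (\<pi> (X k j) (V (\<xi> j)))))"
      if "i < n" "j < n" for i j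
      using X that
      by (simp add: adj_cinner_right[OF Vb] rep_sum[OF rep K] rep_mult[OF rep K] cinner_sum_right
          cinner_rep_left[OF rep K] comm)
    then have "(\<Sum>i<n. \<Sum>j<n. cinner (\<xi> i) (adj V (\<pi> (M i j) (E (V (\<xi> j))))))
        = (\<Sum>i<n. \<Sum>j<n. \<Sum>k<n. cinner (\<pi> (X k i) (V (\<xi> i))) (E (\<pi> (X k j) (V (\<xi> j)))))"
      by simp
    also have "\<dots> = (\<Sum>k<n. \<Sum>i<n. \<Sum>j<n. cinner (\<pi> (X k i) (V (\<xi> i))) (E (\<pi> (X k j) (V (\<xi> j)))))"
      by (rule sum_swap3)
    also have "\<dots> = (\<Sum>k<n. cinner (\<eta> k) (E (\<eta> k)))"
      by (unfold \<eta>_def cinner_sum_left) (simp only: bclinear_sum[OF Eb] cinner_sum_right)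
    finally have eq: "(\<Sum>i<n. \<Sum>j<n. cinner (\<xi> i) (adj V (\<pi> (M i j) (E (V (\<xi> j))))))
        = (\<Sum>k<n. cinner (\<eta> k) (E (\<eta> k)))" .
    have "\<eta> k \<in> K" for k unfolding \<eta>_def by (rule csubspace_sum[OF K]) (rule rep_range[OF rep K])
    then show "Im (\<Sum>i<n. \<Sum>j<n. cinner (\<xi> i) (adj V (\<pi> (M i j) (E (V (\<xi> j)))))) = 0 \<and>
        0 \<le> Re (\<Sum>i<n. \<Sum>j<n. cinner (\<xi> i) (adj V (\<pi> (M i j) (E (V (\<xi> j))))))"
      unfolding eq Im_sum Re_sum using Epos by (auto intro: sum_nonneg)
  qed
qed

section \<open>The sesquilinear form of a completely positive map on formal sums\<close>

text \<open>A list of pairs (a, h) stands for the formal sum of the elementary tensors a \<otimes> h in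
  the algebraic tensor product of the algebra with the Hilbert space.\<close>

definition cp_form :: "('a::cstar_algebra \<Rightarrow> 'h::chilbert \<Rightarrow> 'h) \<Rightarrow> ('a \<times> 'h) list \<Rightarrow> ('a \<times> 'h) list \<Rightarrow> complex"
  where "cp_form \<theta> xs ys = (\<Sum>(b, g)\<leftarrow>xs. \<Sum>(a, f)\<leftarrow>ys. cinner g (\<theta> (invol b * a) f))"

definition stinespring_vec :: "('a \<Rightarrow> 'k \<Rightarrow> 'k) \<Rightarrow> ('h \<Rightarrow> 'k) \<Rightarrow> ('a \<times> 'h) list \<Rightarrow> 'k::chilbert"
  where "stinespring_vec \<pi> V xs = (\<Sum>(a, h)\<leftarrow>xs. \<pi> a (V h))"

lemma cinner_sum_list_left: "cinner (\<Sum>x\<leftarrow>xs. f x) (y::'h::chilbert) = (\<Sum>x\<leftarrow>xs. cinner (f x) y)"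
  by (induction xs) (simp_all add: cinner_add_left)

lemma cinner_sum_list_right: "cinner y (\<Sum>x\<leftarrow>xs. f x) = (\<Sum>x\<leftarrow>xs. cinner (y::'h::chilbert) (f x))"
  by (induction xs) (simp_all add: cinner_add_right)

lemma cp_form_append_left: "cp_form \<theta> (xs @ xs') ys = cp_form \<theta> xs ys + cp_form \<theta> xs' ys"
  by (simp add: cp_form_def)

lemma cp_form_append_right: "cp_form \<theta> xs (ys @ ys') = cp_form \<theta> xs ys + cp_form \<theta> xs ys'"
  by (simp add: cp_form_def case_prod_unfold sum_list_addf)

lemma cp_form_scaleC_left: "cp_form \<theta> (map (apsnd ((*\<^sub>C) c)) xs) ys = cnj c * cp_form \<theta> xs ys"
  by (simp add: cp_form_def case_prod_unfold cinner_scaleC_left sum_list_const_mult o_def)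

lemma cp_form_scaleC_right:
  "(\<And>a. bclinear (\<theta> a)) \<Longrightarrow> cp_form \<theta> xs (map (apsnd ((*\<^sub>C) c)) ys) = c * cp_form \<theta> xs ys"
  by (simp add: cp_form_def case_prod_unfold bclinear_scaleC cinner_scaleC_right sum_list_const_mult o_def)

lemma cp_form_mult_right:
  "cp_form \<theta> xs (map (apfst ((*) a)) ys) = cp_form \<theta> (map (apfst ((*) (invol a))) xs) ys"
  by (simp add: cp_form_def case_prod_unfold o_def invol_mult invol_invol mult.assoc)

lemma cp_form_diff:
  "cp_form (\<lambda>a x. \<theta>1 a x - \<theta>2 a x) xs ys = cp_form \<theta>1 xs ys - cp_form \<theta>2 xs ys"
  by (simp add: cp_form_def case_prod_unfold cinner_diff_right sum_list_subtractf)

lemma positive_mat_rank_one: "positive_mat n (\<lambda>i j. invol (b i) * (b j :: 'a::cstar_algebra))"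
  unfolding positive_mat_def
proof (intro exI[of _ "\<lambda>k i. if k = 0 then b i else 0"] allI impI)
  fix i j assume "i < n" "j < n"
  then have "0 \<in> {..<n}" by simp
  then show "invol (b i) * b j = (\<Sum>k<n. invol (if k = 0 then b i else 0) * (if k = 0 then b j else 0))"
    by (simp add: if_distrib sum.delta' cong: if_cong)
qed

lemma sum_list_map_conv_sum: "(\<Sum>x\<leftarrow>xs. f x) = (\<Sum>i<length xs. f (xs ! i))"
  by (simp add: sum_list_sum_nth atLeast0LessThan)

lemma cp_form_nonneg:
  assumes "cp_map S \<theta>"
  shows "Im (cp_form \<theta> xs xs) = 0 \<and> 0 \<le> Re (cp_form \<theta> xs xs)"
proof -
  let ?b = "\<lambda>i. fst (xs ! i)" and ?g = "\<lambda>i. snd (xs ! i)"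
  have "positive_block (length xs) (\<lambda>i j. \<theta> (invol (?b i) * ?b j))"
    by (rule cp_map_positive_block[OF assms positive_mat_rank_one])
  then have "Im (\<Sum>i<length xs. \<Sum>j<length xs. cinner (?g i) (\<theta> (invol (?b i) * ?b j) (?g j))) = 0 \<and>
      0 \<le> Re (\<Sum>i<length xs. \<Sum>j<length xs. cinner (?g i) (\<theta> (invol (?b i) * ?b j) (?g j)))"
    unfolding positive_block_def by (rule allE[where x = ?g])
  moreover have "cp_form \<theta> xs xs
      = (\<Sum>i<length xs. \<Sum>j<length xs. cinner (?g i) (\<theta> (invol (?b i) * ?b j) (?g j)))"
    unfolding cp_form_def sum_list_map_conv_sum by (simp add: case_prod_unfold)
  ultimately show ?thesis by simp
qed

lemma real_quadratic_nonneg_bound: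
  fixes A B C :: real
  assumes "B \<ge> 0" "C \<ge> 0" "\<And>r. 0 \<le> A - 2 * r * B + r\<^sup>2 * B * C"
  shows "B \<le> A * C"
proof (cases "B = 0")
  case True
  then show ?thesis using assms(2) assms(3)[of 0] by simp
next
  case False
  then have B: "B > 0" using assms(1) by simp
  show ?thesis
  proof (cases "C = 0")
    case True
    have "0 \<le> A - 2 * ((A + 1) / (2 * B)) * B" using assms(3)[of "(A + 1) / (2 * B)"] True by simp
    also have "\<dots> = -1" using B by (simp add: field_simps)
    finally show ?thesis by simp
  next
    case False
    then have C: "C > 0" using assms(2) by simp
    have "0 \<le> A - 2 * (1 / C) * B + (1 / C)\<^sup>2 * B * C" by (rule assms(3))
    also have "\<dots> = A - B / C" using C by (simp add: field_simps power2_eq_square)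
    finally show ?thesis using C by (simp add: field_simps)
  qed
qed

text \<open>Cauchy-Schwarz for a positive semidefinite sesquilinear form, phrased through the
  values A = B(u,u), \<beta> = B(u,v), \<gamma> = B(v,u), D = B(v,v) of the quadratic form along u + t v.\<close>

lemma hermitian_quadratic_Cauchy_Schwarz:
  fixes A \<beta> \<gamma> D :: complex
  assumes pos: "\<And>t. Im (A + t * \<beta> + cnj t * \<gamma> + cnj t * t * D) = 0 \<and>
      0 \<le> Re (A + t * \<beta> + cnj t * \<gamma> + cnj t * t * D)"
    and D: "Im D = 0" "0 \<le> Re D"
  shows "(cmod \<beta>)\<^sup>2 \<le> Re A * Re D"
proof -
  have A: "Im A = 0" "0 \<le> Re A" using pos[of 0] by simp_all
  have "Im \<beta> + Im \<gamma> = 0" using pos[of 1] A D by simp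
  moreover have "Re \<beta> - Re \<gamma> = 0" using pos[of \<i>] A D by simp
  ultimately have \<gamma>: "\<gamma> = cnj \<beta>" by (simp add: complex_eq_iff)
  have nb: "cnj \<beta> * \<beta> = complex_of_real ((cmod \<beta>)\<^sup>2)"
    using complex_norm_square[of \<beta>] by (simp add: mult.commute)
  have "0 \<le> Re A - 2 * r * (cmod \<beta>)\<^sup>2 + r\<^sup>2 * (cmod \<beta>)\<^sup>2 * Re D" for r :: real
  proof -
    define t where "t = - complex_of_real r * cnj \<beta>"
    have "t * \<beta> = - complex_of_real (r * (cmod \<beta>)\<^sup>2)" "cnj t * \<gamma> = - complex_of_real (r * (cmod \<beta>)\<^sup>2)"
      "cnj t * t = complex_of_real (r\<^sup>2 * (cmod \<beta>)\<^sup>2)"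
      unfolding t_def \<gamma> using nb by (simp_all add: algebra_simps power2_eq_square)
    then show ?thesis using pos[of t] A D by (simp add: algebra_simps)
  qed
  then show ?thesis using D by (intro real_quadratic_nonneg_bound) auto
qed

lemma cp_form_Cauchy_Schwarz:
  assumes cp: "cp_map S \<theta>"
  shows "(cmod (cp_form \<theta> xs ys))\<^sup>2 \<le> Re (cp_form \<theta> xs xs) * Re (cp_form \<theta> ys ys)"
proof (rule hermitian_quadratic_Cauchy_Schwarz)
  have bcl: "bclinear (\<theta> a)" for a using cp_map_bclinear[OF cp] .
  fix t
  have "cp_form \<theta> (xs @ map (apsnd ((*\<^sub>C) t)) ys) (xs @ map (apsnd ((*\<^sub>C) t)) ys)
      = cp_form \<theta> xs xs + t * cp_form \<theta> xs ys + cnj t * cp_form \<theta> ys xs + cnj t * t * cp_form \<theta> ys ys"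
    by (simp add: cp_form_append_left cp_form_append_right cp_form_scaleC_left
        cp_form_scaleC_right[OF bcl] algebra_simps)
  then show "Im (cp_form \<theta> xs xs + t * cp_form \<theta> xs ys + cnj t * cp_form \<theta> ys xs + cnj t * t * cp_form \<theta> ys ys) = 0 \<and>
      0 \<le> Re (cp_form \<theta> xs xs + t * cp_form \<theta> xs ys + cnj t * cp_form \<theta> ys xs + cnj t * t * cp_form \<theta> ys ys)"
    using cp_form_nonneg[OF cp] by metis
qed (use cp_form_nonneg[OF cp] in auto)

lemma stinespring_vec_Nil [simp]: "stinespring_vec \<pi> V [] = 0"
  and stinespring_vec_append: "stinespring_vec \<pi> V (xs @ ys) = stinespring_vec \<pi> V xs + stinespring_vec \<pi> V ys"
  by (simp_all add: stinespring_vec_def)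

context
  fixes K :: "'k::chilbert set" and \<pi> :: "'a::cstar_algebra \<Rightarrow> 'k \<Rightarrow> 'k"
  assumes rep: "star_rep K \<pi>" and K: "csubspace K"
begin

lemma stinespring_vec_scaleC:
  "bclinear V \<Longrightarrow> stinespring_vec \<pi> V (map (apsnd ((*\<^sub>C) c)) xs) = c *\<^sub>C stinespring_vec \<pi> V xs"
  by (induction xs)
    (auto simp: stinespring_vec_def bclinear_scaleC rep_bclinear[OF rep K] scaleC_add_right)

lemma stinespring_vec_mult:
  "stinespring_vec \<pi> V (map (apfst ((*) a)) xs) = \<pi> a (stinespring_vec \<pi> V xs)"
  by (induction xs)
    (auto simp: stinespring_vec_def rep_mult[OF rep K] bclinear_add bclinear_zero rep_bclinear[OF rep K])

end

lemma cp_form_stinespring: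
  assumes ms: "min_stinespring H \<phi> K \<pi> V"
  shows "cp_form \<phi> xs ys = cinner (stinespring_vec \<pi> V xs) (stinespring_vec \<pi> V ys)"
proof -
  have K: "csubspace K" and rep: "star_rep K \<pi>" and Vb: "bclinear V"
    using ms by (auto simp: min_stinespring_csubspace min_stinespring_rep intro: is_op_bclinear min_stinespring_op)
  have "cinner g (\<phi> (invol b * a) f) = cinner (\<pi> b (V g)) (\<pi> a (V f))" for a b f g
    by (simp add: min_stinespring_apply[OF ms] rep_mult[OF rep K] adj_cinner_right[OF Vb]
        cinner_rep_left[OF rep K])
  then show ?thesis
    unfolding stinespring_vec_def cinner_sum_list_left
    by (simp add: cp_form_def cinner_sum_list_right case_prod_unfold)
qed

lemma stinespring_vec_proj:
  "is_op H K V \<Longrightarrow> csubspace H \<Longrightarrow> stinespring_vec \<pi> V (map (apsnd (proj H)) xs) = stinespring_vec \<pi> V xs"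
  by (simp add: stinespring_vec_def is_op_right case_prod_unfold o_def)

lemma alg_csubspace_stinespring_range:
  assumes "star_rep K \<pi>" "csubspace K" "bclinear V"
  shows "alg_csubspace (range (stinespring_vec \<pi> V))"
proof (rule alg_csubspaceI)
  show "0 \<in> range (stinespring_vec \<pi> V)" by (metis rangeI stinespring_vec_Nil)
  show "x + y \<in> range (stinespring_vec \<pi> V)" if "x \<in> range (stinespring_vec \<pi> V)" "y \<in> range (stinespring_vec \<pi> V)" for x y
    using that by (auto simp: stinespring_vec_append[symmetric])
  show "c *\<^sub>C x \<in> range (stinespring_vec \<pi> V)" if "x \<in> range (stinespring_vec \<pi> V)" for c x
    using that by (auto simp: stinespring_vec_scaleC[OF assms, symmetric])
qed

lemma closure_stinespring_range:
  assumes ms: "min_stinespring H \<phi> K \<pi> V" and H: "csubspace H"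
  shows "closure (range (stinespring_vec \<pi> V)) = K"
proof -
  have K: "csubspace K" and rep: "star_rep K \<pi>" and V: "is_op H K V"
    using ms by (auto simp: min_stinespring_csubspace min_stinespring_rep min_stinespring_op)
  let ?G = "\<Union>a. (\<lambda>h. \<pi> a (V h)) ` H"
  have "range (stinespring_vec \<pi> V) = span ?G"
  proof
    show "range (stinespring_vec \<pi> V) \<subseteq> span ?G"
    proof (clarify)
      fix xs
      have "\<pi> a (V h) \<in> span ?G" for a h
      proof -
        have "\<pi> a (V (proj H h)) \<in> ?G" using proj_in[OF H] by blast
        then show ?thesis using is_op_right[OF V H, of h] by (metis span_base)
      qed
      then show "stinespring_vec \<pi> V xs \<in> span ?G"
        unfolding stinespring_vec_def by (induction xs) (auto intro: span_add span_zero)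
    qed
    have "alg_csubspace (range (stinespring_vec \<pi> V))"
      by (rule alg_csubspace_stinespring_range[OF rep K is_op_bclinear[OF V]])
    then have "subspace (range (stinespring_vec \<pi> V))"
      unfolding alg_csubspace_def subspace_def by (simp add: scaleR_scaleC)
    moreover have "\<pi> a (V h) = stinespring_vec \<pi> V [(a, h)]" for a h by (simp add: stinespring_vec_def)
    ultimately show "span ?G \<subseteq> range (stinespring_vec \<pi> V)"
      by (intro span_minimal) auto
  qed
  then show ?thesis using min_stinespring_dense[OF ms] by simp
qed

section \<open>The commutant of a pure map\<close>

lemma closure_span_induct:
  assumes "closure (span G) = K" "\<And>g. g \<in> G \<Longrightarrow> P g" "closed {x. P x}" "subspace {x. P x}" "x \<in> K"
  shows "P x"
proof -
  have "span G \<subseteq> {x. P x}" using assms(2,4) by (intro span_minimal) auto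
  then have "closure (span G) \<subseteq> {x. P x}" using assms(3) by (rule closure_minimal)
  then show ?thesis using assms(1,5) by blast
qed

lemma stinespring_commutant_eq_zero:
  assumes ms: "min_stinespring H \<phi> K \<pi> V"
    and G: "is_op K K G" and comm: "\<And>a x. G (\<pi> a x) = \<pi> a (G x)"
    and G0: "\<And>a h. adj V (\<pi> a (G (V h))) = 0"
  shows "G x = 0"
proof -
  have K: "csubspace K" and rep: "star_rep K \<pi>" and Vb: "bclinear V" and Gb: "bclinear G"
    using ms G by (auto simp: min_stinespring_csubspace min_stinespring_rep
        intro: is_op_bclinear min_stinespring_op)
  let ?G = "\<Union>a. (\<lambda>h. \<pi> a (V h)) ` H"
  have dense: "closure (span ?G) = K" by (rule min_stinespring_dense[OF ms])
  have orth: "cinner (\<pi> b (V h')) (G (\<pi> a (V h))) = 0" for a b h h'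
    using G0[of "invol b * a" h]
    by (simp add: comm cinner_rep_left[OF rep K] rep_mult[OF rep K] adj_cinner_right[OF Vb, symmetric])
  have "G g = 0" if "g \<in> ?G" for g
  proof -
    have "cinner y (G g) = 0" if "y \<in> K" for y
      by (rule closure_span_induct[OF dense, where P = "\<lambda>y. cinner y (G g) = 0"])
        (use orth \<open>g \<in> ?G\<close> that in \<open>auto intro: closed_Collect_eq continuous_on_cinner_left
          simp: subspace_def cinner_add_left scaleR_scaleC cinner_scaleC_left\<close>)
    then show ?thesis using is_op_range[OF G K] cinner_self_eq_0 by blast
  qed
  moreover have "closed {x. G x = 0}"
    using closed_Collect_eq[OF bclinear_continuous[OF Gb] continuous_on_const] by simp
  moreover have "subspace {x. G x = 0}"
    by (rule subspaceI) (auto simp: bclinear_zero[OF Gb] bclinear_add[OF Gb] scaleR_scaleC bclinear_scaleC[OF Gb])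
  ultimately have "G y = 0" if "y \<in> K" for y
    using closure_span_induct[OF dense, where P = "\<lambda>x. G x = 0"] that by blast
  then show ?thesis using proj_in[OF K] is_op_right[OF G K] by metis
qed

text \<open>The Radon-Nikodym argument: an operator E in the commutant with 0 \<le> E \<le> 1 splits \<phi>
  into the completely positive maps V* \<pi>(a) E V and V* \<pi>(a) (1 - E) V, so purity forces E
  to be scalar on the range of V, hence on K by minimality.\<close>

lemma pure_cp_commutant_scalar:
  assumes H: "csubspace H" and pure: "pure_cp H \<phi>" and ms: "min_stinespring H \<phi> K \<pi> V"
    and E: "is_op K K E" and comm: "\<And>a x. E (\<pi> a x) = \<pi> a (E x)"
    and Epos: "\<And>\<eta>. \<eta> \<in> K \<Longrightarrow> Im (cinner \<eta> (E \<eta>)) = 0 \<and> 0 \<le> Re (cinner \<eta> (E \<eta>))"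
    and Ele: "\<And>\<eta>. \<eta> \<in> K \<Longrightarrow> Re (cinner \<eta> (E \<eta>)) \<le> (norm \<eta>)\<^sup>2"
  shows "\<exists>c. \<forall>x. E x = c *\<^sub>C proj K x"
proof -
  have K: "csubspace K" and rep: "star_rep K \<pi>" and V: "is_op H K V"
    using ms by (auto simp: min_stinespring_csubspace min_stinespring_rep min_stinespring_op)
  have Vb: "bclinear V" and Eb: "bclinear E" and adjVb: "bclinear (adj V)"
    using V E by (auto intro: is_op_bclinear bclinear_adj)
  have pib: "bclinear (\<pi> a)" for a by (rule rep_bclinear[OF rep K])
  define \<theta> where "\<theta> a x = adj V (\<pi> a (E (V x)))" for a x
  define F where "F = (\<lambda>x. proj K x - E x)"
  have cp\<theta>: "cp_map H \<theta>"
    unfolding \<theta>_def by (rule cp_map_stinespring_commutant[OF H K rep V E comm Epos])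
  have Fop: "is_op K K F"
    unfolding F_def by (rule is_opI[OF bclinear_diff_fun[OF bclinear_proj[OF K] Eb] K])
      (auto simp: F_def csubspace_diff[OF K proj_in[OF K] is_op_range[OF E K]] proj_idem[OF K] is_op_right[OF E K])
  have "cp_map H (\<lambda>a x. adj V (\<pi> a (F (V x))))"
  proof (rule cp_map_stinespring_commutant[OF H K rep V Fop])
    show "F (\<pi> a x) = \<pi> a (F x)" for a x
      by (simp add: F_def comm bclinear_diff[OF pib] proj_id rep_range[OF rep K] rep_proj[OF rep K])
    show "Im (cinner \<eta> (F \<eta>)) = 0 \<and> 0 \<le> Re (cinner \<eta> (F \<eta>))" if "\<eta> \<in> K" for \<eta>
      using Epos[OF that] Ele[OF that] that by (simp add: F_def proj_id cinner_diff_right cinner_self_norm)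
  qed
  moreover have "adj V (\<pi> a (F (V x))) = \<phi> a x - \<theta> a x" for a x
    by (simp add: F_def \<theta>_def min_stinespring_apply[OF ms] is_op_left[OF V K]
        bclinear_diff[OF pib] bclinear_diff[OF adjVb])
  ultimately have "cp_map H (\<lambda>a x. \<phi> a x - \<theta> a x)" by simp
  then obtain c where c: "\<And>a. \<theta> a = (\<lambda>x. c *\<^sub>C \<phi> a x)"
    using pure cp\<theta> unfolding pure_cp_def by blast
  define G where "G = (\<lambda>x. E x - c *\<^sub>C proj K x)"
  have "G x = 0" for x
  proof (rule stinespring_commutant_eq_zero[OF ms, where G = G])
    show "is_op K K G"
      unfolding G_def by (rule is_opI[OF bclinear_diff_fun[OF Eb bclinear_scaleC_fun[OF bclinear_proj[OF K]]] K])
        (auto simp: G_def csubspace_diff[OF K is_op_range[OF E K] csubspace_scaleC[OF K proj_in[OF K]]]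
          proj_idem[OF K] is_op_right[OF E K])
    show "G (\<pi> a x) = \<pi> a (G x)" for a x
      by (simp add: G_def comm bclinear_diff[OF pib] bclinear_scaleC[OF pib] proj_id
          rep_range[OF rep K] rep_proj[OF rep K])
    show "adj V (\<pi> a (G (V h))) = 0" for a h
      using c[of a] unfolding fun_eq_iff
      by (simp add: G_def \<theta>_def min_stinespring_apply[OF ms] is_op_left[OF V K] bclinear_diff[OF pib]
          bclinear_scaleC[OF pib] bclinear_diff[OF adjVb] bclinear_scaleC[OF adjVb])
  qed
  then show ?thesis unfolding G_def by auto
qed

lemma pure_cp_commutant_gram_scalar:
  fixes B :: "'k::chilbert \<Rightarrow> 'l::chilbert"
  assumes H: "csubspace H" and pure: "pure_cp H \<phi>" and ms: "min_stinespring H \<phi> K \<pi> V"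
    and B: "bclinear B" and BK: "\<And>x. B (proj K x) = B x"
    and comm: "\<And>a x. adj B (B (\<pi> a x)) = \<pi> a (adj B (B x))"
  shows "\<exists>c. \<forall>x. adj B (B x) = c *\<^sub>C proj K x"
proof -
  have K: "csubspace K" using min_stinespring_csubspace[OF ms] .
  have pib: "bclinear (\<pi> a)" for a
    using rep_bclinear[OF min_stinespring_rep[OF ms] K] .
  obtain M where M: "M > 0" "\<And>x. norm (B x) \<le> norm x * M" using bclinear_bounded[OF B] by blast
  define r where "r = M\<^sup>2"
  have r: "r > 0" using M(1) by (simp add: r_def)
  define E where "E = (\<lambda>x. complex_of_real (1 / r) *\<^sub>C adj B (B x))"
  have Eb: "bclinear E"
    unfolding E_def by (rule bclinear_scaleC_fun[OF bclinear_comp'[OF bclinear_adj[OF B] B]])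
  have EB: "cinner \<eta> (E \<eta>) = complex_of_real ((norm (B \<eta>))\<^sup>2 / r)" for \<eta>
    by (simp add: E_def cinner_scaleC_right adj_cinner_right[OF B] cinner_self_norm)
  have "\<exists>c. \<forall>x. E x = c *\<^sub>C proj K x"
  proof (rule pure_cp_commutant_scalar[OF H pure ms])
    show "is_op K K E"
      by (rule is_opI[OF Eb K])
        (auto simp: E_def BK intro: csubspace_scaleC[OF K] adj_range[OF B BK K])
    show "E (\<pi> a x) = \<pi> a (E x)" for a x
      by (simp add: E_def comm bclinear_scaleC[OF pib])
    show "Im (cinner \<eta> (E \<eta>)) = 0 \<and> 0 \<le> Re (cinner \<eta> (E \<eta>))" for \<eta>
      using r by (simp add: EB)
    show "Re (cinner \<eta> (E \<eta>)) \<le> (norm \<eta>)\<^sup>2" for \<eta>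
    proof -
      have "(norm (B \<eta>))\<^sup>2 \<le> (norm \<eta> * M)\<^sup>2" using M(2) by (simp add: power_mono)
      then show ?thesis using r by (simp add: EB r_def field_simps power_mult_distrib)
    qed
  qed
  then obtain c where c: "\<And>x. E x = c *\<^sub>C proj K x" by blast
  have "adj B (B x) = complex_of_real r *\<^sub>C E x" for x
    unfolding E_def using r by (simp add: of_real_divide[symmetric] of_real_mult[symmetric])
  then show ?thesis using c by auto
qed

lemma adj_intertwiner:
  assumes repi: "star_rep Ki \<pi>i" "csubspace Ki" and repk: "star_rep Kk \<pi>k" "csubspace Kk"
    and W: "bclinear W" and comm: "\<And>a x. W (\<pi>i a x) = \<pi>k a (W x)"
  shows "adj W (\<pi>k a y) = \<pi>i a (adj W y)"
proof -
  have "W \<circ> \<pi>i (invol a) = \<pi>k (invol a) \<circ> W" by (rule ext) (simp add: comm)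
  then have "adj (W \<circ> \<pi>i (invol a)) = adj (\<pi>k (invol a) \<circ> W)" by simp
  then have "adj (\<pi>i (invol a)) \<circ> adj W = adj W \<circ> adj (\<pi>k (invol a))"
    by (simp add: adj_comp W rep_bclinear[OF repi] rep_bclinear[OF repk])
  then have "\<pi>i a \<circ> adj W = adj W \<circ> \<pi>k a"
    by (simp add: rep_invol[OF repi, symmetric] rep_invol[OF repk, symmetric] invol_invol)
  then show ?thesis by (metis comp_apply)
qed

lemma adj_self_eigenvalue_pos:
  assumes W: "bclinear W" and eig: "adj W (W h) = c *\<^sub>C h" and nz: "W h \<noteq> 0"
  shows "\<exists>r>0. c = complex_of_real r"
proof -
  have h: "h \<noteq> 0" using nz bclinear_zero[OF W] by auto
  define r where "r = (norm (W h))\<^sup>2 / (norm h)\<^sup>2"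
  have "complex_of_real ((norm (W h))\<^sup>2) = c * complex_of_real ((norm h)\<^sup>2)"
    using adj_cinner_right[OF W, of h "W h"] by (simp add: eig cinner_scaleC_right cinner_self_norm)
  then have "c = complex_of_real r" using h by (simp add: r_def field_simps)
  moreover have "r > 0" using nz h by (simp add: r_def)
  ultimately show ?thesis by blast
qed

lemma pure_isometric_intertwiner_coisometric:
  assumes Hk: "csubspace Hk" and pk: "pure_cp Hk \<phi>k" and msk: "min_stinespring Hk \<phi>k Kk \<pi>k Vk"
    and repi: "star_rep Ki \<pi>i" and Ki: "csubspace Ki"
    and U: "is_op Ki Kk U" and UU: "\<And>y. adj U (U y) = proj Ki y"
    and comm: "\<And>a y. U (\<pi>i a y) = \<pi>k a (U y)" and nz: "U x \<noteq> 0"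
  shows "U (adj U y) = proj Kk y"
proof -
  note Kk = min_stinespring_csubspace[OF msk] and repk = min_stinespring_rep[OF msk]
  have Ub: "bclinear U" using is_op_bclinear[OF U] .
  have commadj: "adj U (\<pi>k a z) = \<pi>i a (adj U z)" for a z
    using adj_intertwiner[where W = U and \<pi>i = \<pi>i and \<pi>k = \<pi>k, OF repi Ki repk Kk Ub] comm by blast
  obtain d where d: "\<And>y. U (adj U y) = d *\<^sub>C proj Kk y"
    using pure_cp_commutant_gram_scalar[OF Hk pk msk bclinear_adj[OF Ub]
        is_op_right[OF is_op_adj[OF U Ki Kk] Kk]]
    by (auto simp: adj_adj[OF Ub] comm commadj)
  have "U x = d *\<^sub>C U x"
    using UU[of x] d[of "U x"] is_op_range[OF U Kk] is_op_right[OF U Ki] by (simp add: proj_id)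
  then have "d = 1"
    using nz scaleC_diff_left[of d 1 "U x"] scaleC_eq_0_iff[of "d - 1" "U x"] by simp
  then show ?thesis by (simp add: d)
qed

text \<open>Schur's lemma for disjoint pure maps: W* W is a scalar by purity, so a nonzero
  intertwiner rescales to an isometric one, which is then unitary.\<close>

lemma disjoint_pure_intertwiner_eq_zero:
  assumes Hi: "csubspace Hi" and Hk: "csubspace Hk" and pi: "pure_cp Hi \<phi>i" and pk: "pure_cp Hk \<phi>k"
    and msi: "min_stinespring Hi \<phi>i Ki \<pi>i Vi" and msk: "min_stinespring Hk \<phi>k Kk \<pi>k Vk"
    and neq: "\<not> unitarily_equiv Ki \<pi>i Kk \<pi>k"
    and W: "is_op Ki Kk W" and comm: "\<And>a x. W (\<pi>i a x) = \<pi>k a (W x)"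
  shows "W x = 0"
proof (rule ccontr)
  assume nz: "W x \<noteq> 0"
  note Ki = min_stinespring_csubspace[OF msi] and Kk = min_stinespring_csubspace[OF msk]
    and repi = min_stinespring_rep[OF msi] and repk = min_stinespring_rep[OF msk]
  have Wb: "bclinear W" using is_op_bclinear[OF W] .
  have commadj: "adj W (\<pi>k a y) = \<pi>i a (adj W y)" for a y
    using adj_intertwiner[where W = W and \<pi>i = \<pi>i and \<pi>k = \<pi>k, OF repi Ki repk Kk Wb] comm by blast
  obtain c where c: "\<And>y. adj W (W y) = c *\<^sub>C proj Ki y"
    using pure_cp_commutant_gram_scalar[OF Hi pi msi Wb is_op_right[OF W Ki]] by (auto simp: comm commadj)
  define x1 where "x1 = proj Ki x"
  have x1: "x1 \<in> Ki" "W x1 \<noteq> 0" using nz is_op_right[OF W Ki] proj_in[OF Ki] by (auto simp: x1_def)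
  obtain r where r: "r > 0" "c = complex_of_real r"
    using adj_self_eigenvalue_pos[OF Wb _ x1(2)] c[of x1] x1(1) by (auto simp: proj_id)
  define s where "s = 1 / sqrt r"
  have ss: "complex_of_real s * complex_of_real s * c = 1"
  proof -
    have "s * s * r = 1" using r(1) by (simp add: s_def)
    then show ?thesis unfolding r(2) by (metis of_real_1 of_real_mult)
  qed
  define U where "U = (\<lambda>y. complex_of_real s *\<^sub>C W y)"
  have Ub: "bclinear U" unfolding U_def by (rule bclinear_scaleC_fun[OF Wb])
  have Uop: "is_op Ki Kk U"
    by (rule is_opI[OF Ub Kk]) (auto simp: U_def csubspace_scaleC[OF Kk is_op_range[OF W Kk]] is_op_right[OF W Ki])
  have adjU: "adj U = (\<lambda>y. complex_of_real s *\<^sub>C adj W y)"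
    unfolding U_def by (simp add: adj_scaleC_fun[OF Wb])
  have UU: "adj U (U y) = proj Ki y" for y
    by (simp only: adjU) (simp add: U_def bclinear_scaleC[OF bclinear_adj[OF Wb]] c mult.assoc[symmetric] ss)
  have Ucomm: "U (\<pi>i a y) = \<pi>k a (U y)" for a y
    by (simp add: U_def comm bclinear_scaleC rep_bclinear[OF repk Kk])
  have "U x1 \<noteq> 0" using x1(2) r(1) by (simp add: U_def s_def scaleC_eq_0_iff)
  then have coiso: "U (adj U y) = proj Kk y" for y
    using pure_isometric_intertwiner_coisometric[where U = U and \<pi>i = \<pi>i and \<pi>k = \<pi>k,
        OF Hk pk msk repi Ki Uop UU] Ucomm by blast
  have "unitarily_equiv Ki \<pi>i Kk \<pi>k"
    unfolding unitarily_equiv_def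
  proof (intro exI[of _ U] conjI allI)
    show "adj U \<circ> U = proj Ki" "U \<circ> adj U = proj Kk" "U \<circ> \<pi>i a = \<pi>k a \<circ> U" for a
      by (simp_all add: fun_eq_iff UU coiso Ucomm)
  qed (rule Uop)
  with neq show False by blast
qed

section \<open>Operators from bounded sesquilinear forms on dense subspaces\<close>

lemma closure_cinner_bound:
  fixes z :: "'h::chilbert"
  assumes "\<And>x. x \<in> D \<Longrightarrow> cmod (cinner z x) \<le> C * norm x" "x \<in> closure D"
  shows "cmod (cinner z x) \<le> C * norm x"
proof -
  have "closed {x. cmod (cinner z x) \<le> C * norm x}"
    by (intro closed_Collect_le continuous_on_norm continuous_on_cinner_right continuous_intros)
  then have "closure D \<subseteq> {x. cmod (cinner z x) \<le> C * norm x}"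
    by (rule closure_minimal[rotated]) (use assms(1) in auto)
  then show ?thesis using assms(2) by blast
qed

lemma norm_le_of_cinner_bound:
  fixes z :: "'h::chilbert"
  assumes "z \<in> closure D" "\<And>x. x \<in> D \<Longrightarrow> cmod (cinner z x) \<le> C * norm x" "C \<ge> 0"
  shows "norm z \<le> C"
proof -
  have "cmod (cinner z z) \<le> C * norm z" by (rule closure_cinner_bound[OF assms(2,1)])
  then have "(norm z)\<^sup>2 \<le> C * norm z" by (simp add: cinner_self_norm norm_power)
  then show ?thesis using assms(3) by (cases "norm z = 0") (auto simp: power2_eq_square)
qed

lemma dense_cinner_unique:
  fixes z z' :: "'h::chilbert"
  assumes D: "alg_csubspace D" and "z \<in> closure D" "z' \<in> closure D"
    and eq: "\<And>x. x \<in> D \<Longrightarrow> cinner z x = cinner z' x"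
  shows "z = z'"
proof -
  have "z - z' \<in> closure D" using closure_csubspace[OF D] assms(2,3) by (rule csubspace_diff)
  moreover have "cinner (z - z') x = 0" if "x \<in> D" for x using eq[OF that] by (simp add: cinner_diff_left)
  ultimately have "z - z' = 0" by (rule dense_orth[rotated])
  then show ?thesis by simp
qed

lemma densely_defined_adjoint:
  fixes u :: "'k::chilbert \<Rightarrow> 'h::chilbert"
  assumes D: "alg_csubspace D" and DK: "closure D = Kk" and Ki: "csubspace Ki"
    and u: "\<And>y. y \<in> D \<Longrightarrow> u y \<in> Ki"
    and u_add: "\<And>y y'. y \<in> D \<Longrightarrow> y' \<in> D \<Longrightarrow> u (y + y') = u y + u y'"
    and u_scaleC: "\<And>c y. y \<in> D \<Longrightarrow> u (c *\<^sub>C y) = c *\<^sub>C u y"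
    and u_bound: "\<And>y. y \<in> D \<Longrightarrow> norm (u y) \<le> norm y"
  shows "\<exists>W. is_op Ki Kk W \<and> (\<forall>x. \<forall>y\<in>D. cinner (W x) y = cinner x (u y))"
proof -
  have Kk: "csubspace Kk" unfolding DK[symmetric] by (rule closure_csubspace[OF D])
  have "\<exists>z\<in>closure D. \<forall>y\<in>D. cinner x (u y) = cinner z y" for x
  proof (rule riesz_dense[OF D, where C = "norm x"])
    show "cmod (cinner x (u y)) \<le> norm x * norm y" if "y \<in> D" for y
      using Cauchy_Schwarz[of x "u y"] u_bound[OF that] by (meson mult_left_mono norm_ge_zero order_trans)
  qed (simp_all add: u_add u_scaleC cinner_add_right cinner_scaleC_right)
  then obtain W where W: "\<And>x. W x \<in> Kk" "\<And>x y. y \<in> D \<Longrightarrow> cinner (W x) y = cinner x (u y)"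
    unfolding DK by metis
  have uniq: "z = z'" if "z \<in> Kk" "z' \<in> Kk" "\<And>y. y \<in> D \<Longrightarrow> cinner z y = cinner z' y" for z z'
    by (rule dense_cinner_unique[OF D]) (use that DK in auto)
  have "bclinear W"
  proof (rule bclinear_intro[where K = 1])
    show "W (x + x') = W x + W x'" for x x'
      by (rule uniq) (auto simp: W csubspace_add[OF Kk] cinner_add_left)
    show "W (c *\<^sub>C x) = c *\<^sub>C W x" for c x
      by (rule uniq) (auto simp: W csubspace_scaleC[OF Kk] cinner_scaleC_left)
    show "norm (W x) \<le> norm x * 1" for x
    proof -
      have "cmod (cinner (W x) y) \<le> norm x * norm y" if "y \<in> D" for y
        using W(2)[OF that] Cauchy_Schwarz[of x "u y"] u_bound[OF that]
        by (metis mult_left_mono norm_ge_zero order_trans)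
      then show ?thesis using norm_le_of_cinner_bound[of "W x" D "norm x"] W(1) DK by simp
    qed
  qed
  moreover have "W (proj Ki x) = W x" for x
    by (rule uniq) (auto simp: W proj_selfadj[OF Ki] u proj_id)
  ultimately have "is_op Ki Kk W" using W(1) by (intro is_opI[OF _ Kk])
  then show ?thesis using W(2) by blast
qed

text \<open>The operator is the adjoint of the Riesz representative of the form in the second slot.\<close>

lemma bounded_form_op:
  fixes B :: "'k::chilbert \<Rightarrow> 'h::chilbert \<Rightarrow> complex"
  assumes D: "alg_csubspace D" and DK: "closure D = Kk"
    and E: "alg_csubspace E" and EK: "closure E = Ki"
    and add1: "\<And>y y' x. y\<in>D \<Longrightarrow> y'\<in>D \<Longrightarrow> x\<in>E \<Longrightarrow> B (y + y') x = B y x + B y' x"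
    and scaleC1: "\<And>c y x. y\<in>D \<Longrightarrow> x\<in>E \<Longrightarrow> B (c *\<^sub>C y) x = cnj c * B y x"
    and add2: "\<And>y x x'. y\<in>D \<Longrightarrow> x\<in>E \<Longrightarrow> x'\<in>E \<Longrightarrow> B y (x + x') = B y x + B y x'"
    and scaleC2: "\<And>c y x. y\<in>D \<Longrightarrow> x\<in>E \<Longrightarrow> B y (c *\<^sub>C x) = c * B y x"
    and bound: "\<And>y x. y\<in>D \<Longrightarrow> x\<in>E \<Longrightarrow> cmod (B y x) \<le> norm y * norm x"
  shows "\<exists>W. is_op Ki Kk W \<and> (\<forall>y\<in>D. \<forall>x\<in>E. cinner y (W x) = B y x)"
proof -
  have Ki: "csubspace Ki" unfolding EK[symmetric] by (rule closure_csubspace[OF E])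
  have "\<exists>z\<in>closure E. \<forall>x\<in>E. B y x = cinner z x" if "y \<in> D" for y
    by (rule riesz_dense[OF E, where C = "norm y"]) (auto simp: add2 scaleC2 bound that)
  then obtain u where u: "\<And>y. y \<in> D \<Longrightarrow> u y \<in> Ki" "\<And>y x. y \<in> D \<Longrightarrow> x \<in> E \<Longrightarrow> B y x = cinner (u y) x"
    unfolding EK by metis
  have uniq: "z = z'" if "z \<in> Ki" "z' \<in> Ki" "\<And>x. x \<in> E \<Longrightarrow> cinner z x = cinner z' x" for z z'
    by (rule dense_cinner_unique[OF E]) (use that EK in auto)
  have "\<exists>W. is_op Ki Kk W \<and> (\<forall>x. \<forall>y\<in>D. cinner (W x) y = cinner x (u y))"
  proof (rule densely_defined_adjoint[OF D DK Ki u(1)])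
    show "u (y + y') = u y + u y'" if "y \<in> D" "y' \<in> D" for y y'
      by (rule uniq) (use that u add1 alg_csubspace_add[OF D] in \<open>auto simp: csubspace_add[OF Ki] cinner_add_left\<close>)
    show "u (c *\<^sub>C y) = c *\<^sub>C u y" if "y \<in> D" for c y
      by (rule uniq) (use that u scaleC1 alg_csubspace_scaleC[OF D] in \<open>auto simp: csubspace_scaleC[OF Ki] cinner_scaleC_left\<close>)
    show "norm (u y) \<le> norm y" if "y \<in> D" for y
      using norm_le_of_cinner_bound[of "u y" E "norm y"] u[OF that] bound[OF that] EK by simp
  qed
  then obtain W where W: "is_op Ki Kk W" "\<And>x y. y \<in> D \<Longrightarrow> cinner (W x) y = cinner x (u y)"
    by blast
  have "cinner y (W x) = B y x" if "y \<in> D" "x \<in> E" for y x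
    using W(2)[OF that(1), of x] u(2)[OF that] by (metis cinner_cnj)
  then show ?thesis using W(1) by blast
qed

section \<open>Completely positive maps dominated by a sum of disjoint pure maps\<close>

lemma cp_form_compress:
  assumes "csubspace M" "csubspace N"
  shows "cp_form (\<lambda>a x. proj M (\<theta> a (proj N x))) xs ys
    = cp_form \<theta> (map (apsnd (proj M)) xs) (map (apsnd (proj N)) ys)"
  by (simp add: cp_form_def case_prod_unfold o_def proj_selfadj[OF assms(1)])

lemma cp_form_compress_le_stinespring:
  assumes H: "csubspace H" and ms: "min_stinespring H \<phi> K \<pi> V"
    and cpd: "cp_map S (\<lambda>a x. \<Phi> a x - \<theta> a x)"
    and \<Phi>: "\<And>a x y. x \<in> H \<Longrightarrow> y \<in> H \<Longrightarrow> cinner x (\<Phi> a y) = cinner x (\<phi> a y)"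
  shows "Re (cp_form \<theta> (map (apsnd (proj H)) xs) (map (apsnd (proj H)) xs)) \<le> (norm (stinespring_vec \<pi> V xs))\<^sup>2"
proof -
  let ?ys = "map (apsnd (proj H)) xs"
  have "cp_form \<Phi> ?ys ?ys = cp_form \<phi> ?ys ?ys"
    by (simp add: cp_form_def case_prod_unfold o_def \<Phi> proj_in[OF H])
  also have "\<dots> = cinner (stinespring_vec \<pi> V xs) (stinespring_vec \<pi> V xs)"
    by (simp add: cp_form_stinespring[OF ms] stinespring_vec_proj[OF min_stinespring_op[OF ms] H])
  finally have "cp_form \<Phi> ?ys ?ys = complex_of_real ((norm (stinespring_vec \<pi> V xs))\<^sup>2)"
    by (simp add: cinner_self_norm)
  then show ?thesis
    using cp_form_nonneg[OF cpd, of ?ys] by (simp add: cp_form_diff)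
qed

context
  fixes S Hi Hk :: "'h::chilbert set" and \<phi>i \<phi>k \<Phi> \<theta> :: "'a::cstar_algebra \<Rightarrow> 'h \<Rightarrow> 'h"
    and Ki Kk :: "'k::chilbert set" and \<pi>i \<pi>k :: "'a \<Rightarrow> 'k \<Rightarrow> 'k" and Vi Vk :: "'h \<Rightarrow> 'k"
  assumes Hi: "csubspace Hi" and Hk: "csubspace Hk"
    and msi: "min_stinespring Hi \<phi>i Ki \<pi>i Vi" and msk: "min_stinespring Hk \<phi>k Kk \<pi>k Vk"
    and cp\<theta>: "cp_map S \<theta>" and cpd: "cp_map S (\<lambda>a x. \<Phi> a x - \<theta> a x)"
    and \<Phi>i: "\<And>a x y. x \<in> Hi \<Longrightarrow> y \<in> Hi \<Longrightarrow> cinner x (\<Phi> a y) = cinner x (\<phi>i a y)"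
    and \<Phi>k: "\<And>a x y. x \<in> Hk \<Longrightarrow> y \<in> Hk \<Longrightarrow> cinner x (\<Phi> a y) = cinner x (\<phi>k a y)"
begin

lemma cp_form_compress_bound:
  "cmod (cp_form (\<lambda>a x. proj Hk (\<theta> a (proj Hi x))) xs ys)
    \<le> norm (stinespring_vec \<pi>k Vk xs) * norm (stinespring_vec \<pi>i Vi ys)"
proof -
  let ?xs = "map (apsnd (proj Hk)) xs" and ?ys = "map (apsnd (proj Hi)) ys"
  have "(cmod (cp_form \<theta> ?xs ?ys))\<^sup>2 \<le> Re (cp_form \<theta> ?xs ?xs) * Re (cp_form \<theta> ?ys ?ys)"
    by (rule cp_form_Cauchy_Schwarz[OF cp\<theta>])
  also have "\<dots> \<le> (norm (stinespring_vec \<pi>k Vk xs))\<^sup>2 * (norm (stinespring_vec \<pi>i Vi ys))\<^sup>2"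
    by (rule mult_mono[OF cp_form_compress_le_stinespring[OF Hk msk cpd \<Phi>k]
        cp_form_compress_le_stinespring[OF Hi msi cpd \<Phi>i]]) (use cp_form_nonneg[OF cp\<theta>] in auto)
  finally have "(cmod (cp_form \<theta> ?xs ?ys))\<^sup>2
      \<le> (norm (stinespring_vec \<pi>k Vk xs) * norm (stinespring_vec \<pi>i Vi ys))\<^sup>2"
    by (simp add: power_mult_distrib)
  then show ?thesis unfolding cp_form_compress[OF Hk Hi] by (rule power2_le_imp_le) simp
qed

lemma cp_form_compress_operator:
  "\<exists>W. is_op Ki Kk W \<and> (\<forall>xs ys. cinner (stinespring_vec \<pi>k Vk xs) (W (stinespring_vec \<pi>i Vi ys))
      = cp_form (\<lambda>a x. proj Hk (\<theta> a (proj Hi x))) xs ys)"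
proof -
  let ?B = "cp_form (\<lambda>a x. proj Hk (\<theta> a (proj Hi x)))"
  let ?vi = "stinespring_vec \<pi>i Vi" and ?vk = "stinespring_vec \<pi>k Vk"
  note Ki = min_stinespring_csubspace[OF msi] and Kk = min_stinespring_csubspace[OF msk]
    and repi = min_stinespring_rep[OF msi] and repk = min_stinespring_rep[OF msk]
    and Vib = is_op_bclinear[OF min_stinespring_op[OF msi]]
    and Vkb = is_op_bclinear[OF min_stinespring_op[OF msk]]
  have bcl: "bclinear (\<lambda>x. proj Hk (\<theta> a (proj Hi x)))" for a
    by (rule bclinear_comp'[OF bclinear_proj[OF Hk] bclinear_comp'[OF cp_map_bclinear[OF cp\<theta>] bclinear_proj[OF Hi]]])
  have welldef: "?B xs ys = ?B xs' ys'" if "?vk xs = ?vk xs'" "?vi ys = ?vi ys'" for xs xs' ys ys'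
  proof -
    let ?xs = "xs @ map (apsnd ((*\<^sub>C) (-1))) xs'" and ?ys = "ys @ map (apsnd ((*\<^sub>C) (-1))) ys'"
    have "?vk ?xs = 0" "?vi ?ys = 0"
      using that by (simp_all add: stinespring_vec_append stinespring_vec_scaleC[OF repk Kk Vkb]
          stinespring_vec_scaleC[OF repi Ki Vib] scaleC_minus_left)
    then have "?B ?xs ys = 0" "?B xs' ?ys = 0"
      using cp_form_compress_bound[of ?xs ys] cp_form_compress_bound[of xs' ?ys] by simp_all
    then show ?thesis
      by (simp add: cp_form_append_left cp_form_append_right cp_form_scaleC_left cp_form_scaleC_right[OF bcl])
  qed
  define Bv where "Bv y x = ?B (SOME xs. y = ?vk xs) (SOME ys. x = ?vi ys)" for y x
  have Bv: "Bv (?vk xs) (?vi ys) = ?B xs ys" for xs ys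
    unfolding Bv_def by (rule welldef[symmetric]) (metis (mono_tags) someI_ex)+
  have "\<exists>W. is_op Ki Kk W \<and> (\<forall>y\<in>range ?vk. \<forall>x\<in>range ?vi. cinner y (W x) = Bv y x)"
  proof (rule bounded_form_op[OF alg_csubspace_stinespring_range[OF repk Kk Vkb]
        closure_stinespring_range[OF msk Hk] alg_csubspace_stinespring_range[OF repi Ki Vib]
        closure_stinespring_range[OF msi Hi]])
  qed (auto simp: Bv stinespring_vec_append[symmetric] stinespring_vec_scaleC[OF repk Kk Vkb, symmetric]
      stinespring_vec_scaleC[OF repi Ki Vib, symmetric] cp_form_append_left cp_form_append_right
      cp_form_scaleC_left cp_form_scaleC_right[OF bcl] cp_form_compress_bound)
  then show ?thesis by (auto simp: Bv)
qed

end

lemma stinespring_intertwinerI: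
  assumes msi: "min_stinespring Hi \<phi>i Ki \<pi>i Vi" and msk: "min_stinespring Hk \<phi>k Kk \<pi>k Vk"
    and Hi: "csubspace Hi" and Hk: "csubspace Hk" and W: "is_op Ki Kk W"
    and coeff: "\<And>a xs ys. cinner (stinespring_vec \<pi>k Vk xs) (W (stinespring_vec \<pi>i Vi (map (apfst ((*) a)) ys)))
      = cinner (stinespring_vec \<pi>k Vk (map (apfst ((*) (invol a))) xs)) (W (stinespring_vec \<pi>i Vi ys))"
  shows "W (\<pi>i a x) = \<pi>k a (W x)"
proof -
  have Ki: "csubspace Ki" and Kk: "csubspace Kk" and repi: "star_rep Ki \<pi>i" and repk: "star_rep Kk \<pi>k"
    using msi msk by (auto simp: min_stinespring_csubspace min_stinespring_rep)
  have Wb: "bclinear W" using is_op_bclinear[OF W] .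
  have pib: "bclinear (\<pi>i a)" and pkb: "bclinear (\<pi>k a)"
    using rep_bclinear[OF repi Ki] rep_bclinear[OF repk Kk] .
  have on_vec: "W (\<pi>i a y) = \<pi>k a (W y)" if yr: "y \<in> range (stinespring_vec \<pi>i Vi)" for y
  proof -
    obtain ys where y: "y = stinespring_vec \<pi>i Vi ys" using yr by blast
    define z where "z = W (\<pi>i a y) - \<pi>k a (W y)"
    have "z \<in> closure (range (stinespring_vec \<pi>k Vk))"
      unfolding closure_stinespring_range[OF msk Hk] z_def
      by (rule csubspace_diff[OF Kk is_op_range[OF W Kk] rep_range[OF repk Kk]])
    moreover have "cinner z v = 0" if vr: "v \<in> range (stinespring_vec \<pi>k Vk)" for v
    proof -
      obtain xs where v: "v = stinespring_vec \<pi>k Vk xs" using vr by blast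
      have "cinner v z = 0"
        using coeff[of xs a ys]
        by (simp add: z_def y v cinner_diff_right cinner_rep_right[OF repk Kk]
            stinespring_vec_mult[OF repi Ki, symmetric] stinespring_vec_mult[OF repk Kk, symmetric])
      then show ?thesis using cinner_cnj[of v z] by simp
    qed
    ultimately have "z = 0" by (intro dense_orth) auto
    then show ?thesis unfolding z_def by simp
  qed
  have "W (\<pi>i a y) = \<pi>k a (W y)" if "y \<in> Ki" for y
  proof (rule dense_eq[where D = "range (stinespring_vec \<pi>i Vi)"])
    show "continuous_on UNIV (\<lambda>x. W (\<pi>i a x))" "continuous_on UNIV (\<lambda>x. \<pi>k a (W x))"
      by (rule bclinear_continuous[OF bclinear_comp'[OF Wb pib]] bclinear_continuous[OF bclinear_comp'[OF pkb Wb]])+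
  qed (use on_vec that closure_stinespring_range[OF msi Hi] in auto)
  then show ?thesis
    using proj_in[OF Ki, of x] rep_proj[OF repi Ki] is_op_right[OF W Ki] by metis
qed

lemma disjoint_pure_cp_offdiag_eq_zero:
  assumes Hi: "csubspace Hi" and Hk: "csubspace Hk" and pi: "pure_cp Hi \<phi>i" and pk: "pure_cp Hk \<phi>k"
    and msi: "min_stinespring Hi \<phi>i Ki \<pi>i Vi" and msk: "min_stinespring Hk \<phi>k Kk \<pi>k Vk"
    and neq: "\<not> unitarily_equiv Ki \<pi>i Kk \<pi>k"
    and cp\<theta>: "cp_map S \<theta>" and cpd: "cp_map S (\<lambda>a x. \<Phi> a x - \<theta> a x)"
    and \<Phi>i: "\<And>a x y. x \<in> Hi \<Longrightarrow> y \<in> Hi \<Longrightarrow> cinner x (\<Phi> a y) = cinner x (\<phi>i a y)"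
    and \<Phi>k: "\<And>a x y. x \<in> Hk \<Longrightarrow> y \<in> Hk \<Longrightarrow> cinner x (\<Phi> a y) = cinner x (\<phi>k a y)"
  shows "cinner (proj Hk h') (\<theta> a (proj Hi h)) = 0"
proof -
  obtain W where W: "is_op Ki Kk W" and coeff: "\<And>xs ys. cinner (stinespring_vec \<pi>k Vk xs)
      (W (stinespring_vec \<pi>i Vi ys)) = cp_form (\<lambda>a x. proj Hk (\<theta> a (proj Hi x))) xs ys"
    using cp_form_compress_operator[OF Hi Hk msi msk cp\<theta> cpd \<Phi>i \<Phi>k] by blast
  have "W (\<pi>i b x) = \<pi>k b (W x)" for b x
    by (rule stinespring_intertwinerI[OF msi msk Hi Hk W]) (simp add: coeff cp_form_mult_right)
  then have "W x = 0" for x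
    using disjoint_pure_intertwiner_eq_zero[OF Hi Hk pi pk msi msk neq W] by blast
  then have "cp_form (\<lambda>a x. proj Hk (\<theta> a (proj Hi x))) [(1, h')] [(a, h)] = 0"
    using coeff[of "[(1, h')]" "[(a, h)]"] by simp
  then show ?thesis by (simp add: cp_form_def proj_selfadj[OF Hk])
qed

section \<open>Orthogonal direct sums\<close>

lemma sum_eq_single:
  "i < (n::nat) \<Longrightarrow> (\<And>l. l < n \<Longrightarrow> l \<noteq> i \<Longrightarrow> f l = 0) \<Longrightarrow> (\<Sum>l<n. f l) = (f i :: 'v::comm_monoid_add)"
  by (rule sum.mono_neutral_right[of "{..<n}" "{i}", simplified]) auto

locale orthogonal_blocks =
  fixes n :: nat and H :: "nat \<Rightarrow> 'h::chilbert set" and \<phi> :: "nat \<Rightarrow> 'a::cstar_algebra \<Rightarrow> 'h \<Rightarrow> 'h"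
  assumes csubspace_block: "\<And>i. i < n \<Longrightarrow> csubspace (H i)"
    and orthogonal_blocks: "\<And>i j x y. i < n \<Longrightarrow> j < n \<Longrightarrow> i \<noteq> j \<Longrightarrow> x \<in> H i \<Longrightarrow> y \<in> H j \<Longrightarrow> cinner x y = 0"
    and ucp_block: "\<And>i. i < n \<Longrightarrow> ucp_map (H i) (\<phi> i)"
begin

definition S where "S = {(\<Sum>i<n. x i) | x. \<forall>i<n. x i \<in> H i}"
definition P where "P i = proj (H i)"
definition Phi where "Phi a y = (\<Sum>i<n. \<phi> i a y)"
definition diag where "diag \<alpha> x = (\<Sum>i<n. \<alpha> i *\<^sub>C P i x)"

lemma P_in: "i < n \<Longrightarrow> P i x \<in> H i" unfolding P_def using proj_in csubspace_block by blast
lemma P_id: "i < n \<Longrightarrow> x \<in> H i \<Longrightarrow> P i x = x" unfolding P_def by (rule proj_id)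
lemma P_bclinear: "i < n \<Longrightarrow> bclinear (P i)" unfolding P_def using bclinear_proj csubspace_block by blast

lemma P_other: "i < n \<Longrightarrow> l < n \<Longrightarrow> l \<noteq> i \<Longrightarrow> y \<in> H i \<Longrightarrow> P l y = 0"
  unfolding P_def by (rule proj_orth_zero) (auto simp: csubspace_0 csubspace_block orthogonal_blocks)

lemma cp_block: "i < n \<Longrightarrow> cp_map (H i) (\<phi> i)"
  and \<phi>_one: "i < n \<Longrightarrow> \<phi> i 1 = P i"
  using ucp_block unfolding ucp_map_def P_def by blast+

lemma \<phi>_in: "i < n \<Longrightarrow> \<phi> i a y \<in> H i"
  using is_op_range cp_map_op[OF cp_block] csubspace_block by blast
lemma \<phi>_P: "i < n \<Longrightarrow> \<phi> i a (P i y) = \<phi> i a y"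
  unfolding P_def using is_op_right cp_map_op[OF cp_block] csubspace_block by blast
lemma \<phi>_bclinear: "i < n \<Longrightarrow> bclinear (\<phi> i a)"
  using cp_map_bclinear[OF cp_block] by blast

lemma \<phi>_other: "i < n \<Longrightarrow> l < n \<Longrightarrow> l \<noteq> i \<Longrightarrow> y \<in> H i \<Longrightarrow> \<phi> l a y = 0"
  using \<phi>_P[of l a y] P_other[of i l y] bclinear_zero[OF \<phi>_bclinear[of l a]] by simp

lemma P_\<phi>: "i < n \<Longrightarrow> l < n \<Longrightarrow> P l (\<phi> i a y) = (if l = i then \<phi> i a y else 0)"
  using P_other P_id \<phi>_in by auto

lemma Phi_block: "i < n \<Longrightarrow> y \<in> H i \<Longrightarrow> Phi a y = \<phi> i a y"
  unfolding Phi_def by (rule sum_eq_single) (auto simp: \<phi>_other)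

lemma Phi_P: "i < n \<Longrightarrow> Phi a (P i y) = \<phi> i a y"
  by (simp add: Phi_block P_in \<phi>_P)

lemma proj_S: "proj S x = (\<Sum>i<n. P i x)"
proof (rule proj_eqI)
  show "(\<Sum>i<n. P i x) \<in> S" unfolding S_def using P_in by blast
  show "\<forall>z\<in>S. cinner z (x - (\<Sum>i<n. P i x)) = 0"
  proof
    fix z assume "z \<in> S"
    then obtain zs where z: "z = (\<Sum>i<n. zs i)" and zs: "\<And>i. i < n \<Longrightarrow> zs i \<in> H i"
      unfolding S_def by blast
    have "cinner (zs i) (\<Sum>l<n. P l x) = cinner (zs i) x" if i: "i < n" for i
    proof -
      have "cinner (zs i) (\<Sum>l<n. P l x) = cinner (zs i) (P i x)"
        unfolding cinner_sum_right by (rule sum_eq_single[OF i]) (use orthogonal_blocks i zs P_in in auto)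
      also have "\<dots> = cinner (zs i) x"
        unfolding P_def using proj_orth'[OF csubspace_block[OF i] zs[OF i]] by simp
      finally show ?thesis .
    qed
    then show "cinner z (x - (\<Sum>i<n. P i x)) = 0"
      unfolding z by (simp add: cinner_sum_left cinner_diff_right sum_subtractf)
  qed
qed

lemma S_iff: "x \<in> S \<longleftrightarrow> (\<Sum>i<n. P i x) = x"
proof
  assume "x \<in> S"
  then show "(\<Sum>i<n. P i x) = x" using proj_S[of x] proj_id[of x S] by simp
next
  assume "(\<Sum>i<n. P i x) = x"
  moreover have "(\<Sum>i<n. P i x) \<in> S" unfolding S_def using P_in by blast
  ultimately show "x \<in> S" by simp
qed

lemma csubspace_S: "csubspace S"
proof -
  have "0 \<in> S" unfolding S_iff by (simp add: bclinear_zero[OF P_bclinear])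
  moreover have "x + y \<in> S" if "x \<in> S" "y \<in> S" for x y
    using that unfolding S_iff by (simp add: bclinear_add[OF P_bclinear] sum.distrib)
  moreover have "c *\<^sub>C x \<in> S" if "x \<in> S" for c x
    using that unfolding S_iff by (simp add: bclinear_scaleC[OF P_bclinear] scaleC_sum_right[symmetric])
  moreover have "closed S"
  proof -
    have "continuous_on UNIV (\<lambda>x. \<Sum>i<n. P i x)"
      by (rule bclinear_continuous[OF bclinear_sum_fun[OF P_bclinear]]) simp
    then have "closed {x. (\<Sum>i<n. P i x) = x}" using closed_Collect_eq continuous_on_id by blast
    moreover have "S = {x. (\<Sum>i<n. P i x) = x}" using S_iff by blast
    ultimately show ?thesis by simp
  qed
  ultimately show ?thesis unfolding csubspace_def by blast
qed

lemma block_subset_S: "i < n \<Longrightarrow> h \<in> H i \<Longrightarrow> h \<in> S"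
  unfolding S_iff using sum_eq_single[of i n "\<lambda>l. P l h"] by (simp add: P_other P_id)

lemma ucp_map_Phi: "ucp_map S Phi"
  unfolding ucp_map_def
proof
  have Phi_bclinear: "bclinear (Phi a)" for a
    unfolding Phi_def[abs_def] by (rule bclinear_sum_fun) (simp add: \<phi>_bclinear)
  show "cp_map S Phi"
  proof (rule cp_mapI)
    show "is_op S S (Phi a)" for a
    proof (rule is_opI[OF Phi_bclinear csubspace_S])
      show "Phi a y \<in> S" for y unfolding Phi_def S_def using \<phi>_in by blast
      show "Phi a (proj S y) = Phi a y" for y
        by (simp add: proj_S bclinear_sum[OF Phi_bclinear] Phi_P) (simp add: Phi_def)
    qed
    show "Phi (a + b) x = Phi a x + Phi b x" "Phi (c *\<^sub>C a) x = c *\<^sub>C Phi a x" for a b c x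
      by (simp_all add: Phi_def cp_map_add[OF cp_block] cp_map_scaleC[OF cp_block] sum.distrib scaleC_sum_right)
    show "positive_block m (\<lambda>i j. Phi (M i j))" if "positive_mat m M" for m M
      using positive_block_sum[of "{..<n}" m "\<lambda>l i j. \<phi> l (M i j)"] cp_map_positive_block[OF cp_block that]
      unfolding Phi_def[abs_def] by simp
  qed
  show "Phi 1 = proj S" by (rule ext) (simp add: Phi_def proj_S \<phi>_one)
qed

lemma diag_bclinear: "bclinear (diag \<alpha>)"
  unfolding diag_def[abs_def] by (intro bclinear_sum_fun bclinear_scaleC_fun P_bclinear) simp

lemma P_diag: "l < n \<Longrightarrow> P l (diag \<alpha> x) = \<alpha> l *\<^sub>C P l x"
proof -
  assume l: "l < n"
  have "P l (diag \<alpha> x) = (\<Sum>i<n. \<alpha> i *\<^sub>C P l (P i x))" unfolding diag_def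
    by (simp add: bclinear_sum[OF P_bclinear[OF l]] bclinear_scaleC[OF P_bclinear[OF l]])
  also have "\<dots> = \<alpha> l *\<^sub>C P l (P l x)" by (rule sum_eq_single[OF l]) (simp add: P_other P_in l)
  finally show ?thesis by (simp add: P_id P_in l)
qed

lemma diag_diag: "diag \<alpha> (diag \<beta> x) = diag (\<lambda>i. \<alpha> i * \<beta> i) x"
proof -
  have "diag \<alpha> (diag \<beta> x) = (\<Sum>i<n. \<alpha> i *\<^sub>C P i (diag \<beta> x))" by (simp only: diag_def[of \<alpha>])
  also have "\<dots> = (\<Sum>i<n. (\<alpha> i * \<beta> i) *\<^sub>C P i x)" by (rule sum.cong[OF refl]) (simp add: P_diag)
  finally show ?thesis by (simp only: diag_def)
qed

lemma diag_one: "diag (\<lambda>_. 1) x = proj S x"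
  unfolding diag_def proj_S by simp

lemma diag_cong: "(\<And>i. i < n \<Longrightarrow> \<alpha> i = \<beta> i) \<Longrightarrow> diag \<alpha> = diag \<beta>"
  unfolding diag_def[abs_def] by simp

lemma diag_op: "is_op S S (diag \<alpha>)"
proof (rule is_opI[OF diag_bclinear csubspace_S])
  show "diag \<alpha> x \<in> S" for x
    unfolding diag_def S_def using csubspace_scaleC csubspace_block P_in by blast
  show "diag \<alpha> (proj S x) = diag \<alpha> x" for x
    using diag_diag[of \<alpha> "\<lambda>_. 1" x] by (simp add: diag_one)
qed

lemma adj_diag: "adj (diag \<alpha>) = diag (\<lambda>i. cnj (\<alpha> i))"
proof (rule adj_eqI)
  fix y z
  have "cinner (diag (\<lambda>i. cnj (\<alpha> i)) y) z = (\<Sum>i<n. \<alpha> i * cinner (P i y) z)"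
    unfolding diag_def by (simp add: cinner_sum_left cinner_scaleC_left)
  also have "\<dots> = (\<Sum>i<n. \<alpha> i * cinner y (P i z))"
    unfolding P_def by (intro sum.cong refl) (simp add: proj_selfadj csubspace_block)
  also have "\<dots> = cinner y (diag \<alpha> z)"
    unfolding diag_def by (simp add: cinner_sum_right cinner_scaleC_right)
  finally show "cinner (diag (\<lambda>i. cnj (\<alpha> i)) y) z = cinner y (diag \<alpha> z)" .
qed

lemma diag_Phi_diag: "diag \<alpha> (Phi a (diag \<beta> y)) = (\<Sum>i<n. (\<alpha> i * \<beta> i) *\<^sub>C \<phi> i a y)"
proof -
  have "\<phi> i a (diag \<beta> y) = \<beta> i *\<^sub>C \<phi> i a y" if i: "i < n" for i
    using \<phi>_P[OF i, of a "diag \<beta> y"] \<phi>_P[OF i, of a y]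
    by (simp add: P_diag i bclinear_scaleC[OF \<phi>_bclinear[OF i]])
  then have "diag \<alpha> (Phi a (diag \<beta> y)) = (\<Sum>i<n. \<alpha> i *\<^sub>C P i (\<Sum>l<n. \<beta> l *\<^sub>C \<phi> l a y))"
    by (simp add: Phi_def diag_def)
  also have "\<dots> = (\<Sum>i<n. (\<alpha> i * \<beta> i) *\<^sub>C \<phi> i a y)"
  proof (rule sum.cong[OF refl])
    fix i assume "i \<in> {..<n}"
    then have i: "i < n" by simp
    have "P i (\<Sum>l<n. \<beta> l *\<^sub>C \<phi> l a y) = (\<Sum>l<n. \<beta> l *\<^sub>C P i (\<phi> l a y))"
      by (simp add: bclinear_sum[OF P_bclinear[OF i]] bclinear_scaleC[OF P_bclinear[OF i]])
    also have "\<dots> = \<beta> i *\<^sub>C P i (\<phi> i a y)" by (rule sum_eq_single[OF i]) (auto simp: P_\<phi> i)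
    finally show "\<alpha> i *\<^sub>C P i (\<Sum>l<n. \<beta> l *\<^sub>C \<phi> l a y) = (\<alpha> i * \<beta> i) *\<^sub>C \<phi> i a y"
      by (simp add: P_\<phi> i)
  qed
  finally show ?thesis .
qed

lemma block_decomposition:
  assumes \<theta>: "is_op S S \<theta>"
    and off: "\<And>i k h h'. i < n \<Longrightarrow> k < n \<Longrightarrow> i \<noteq> k \<Longrightarrow> cinner (P k h') (\<theta> (P i h)) = 0"
    and diag: "\<And>i x. i < n \<Longrightarrow> P i (\<theta> (P i x)) = c i *\<^sub>C \<phi> i a x"
  shows "\<theta> x = (\<Sum>i<n. c i *\<^sub>C \<phi> i a x)"
proof -
  have \<theta>b: "bclinear \<theta>" using is_op_bclinear[OF \<theta>] .
  have off0: "P k (\<theta> (P i x)) = 0" if "i < n" "k < n" "i \<noteq> k" for i k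
    by (rule cinner_eq_0_imp_eq_0)
      (use off[OF that] in \<open>simp add: P_def proj_selfadj[OF csubspace_block[OF that(2)], symmetric]\<close>)
  have "\<theta> x = proj S (\<theta> (proj S x))" using \<theta> csubspace_S by (simp add: is_op_left is_op_right)
  also have "\<dots> = (\<Sum>k<n. \<Sum>i<n. P k (\<theta> (P i x)))"
    unfolding proj_S by (simp add: bclinear_sum[OF \<theta>b] bclinear_sum[OF P_bclinear])
  also have "\<dots> = (\<Sum>k<n. P k (\<theta> (P k x)))"
    by (intro sum.cong refl sum_eq_single) (auto simp: off0)
  finally show ?thesis by (simp add: diag)
qed

lemma ucp_inv_Phi:
  assumes "\<And>i g a. i < n \<Longrightarrow> g \<in> carrier G \<Longrightarrow> \<phi> i (\<tau> g a) = \<phi> i a"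
  shows "ucp_inv G \<tau> S Phi"
  using ucp_map_Phi assms by (simp add: ucp_inv_def Phi_def[abs_def])

lemma gram_diag_coeffs_pos:
  assumes T: "is_op S S T" and RT: "\<And>x. R (T x) = proj S x" and R: "bclinear R"
    and gram: "\<And>x. adj T (T x) = (\<Sum>i<n. c i *\<^sub>C P i x)" and i: "i < n"
  shows "\<exists>r>0. \<forall>x. c i *\<^sub>C P i x = complex_of_real r *\<^sub>C P i x"
proof (cases "\<exists>h\<in>H i. h \<noteq> 0")
  case True
  then obtain h where h: "h \<in> H i" "h \<noteq> 0" by blast
  have "T h \<noteq> 0"
    using RT[of h] bclinear_zero[OF R] h proj_id[OF block_subset_S[OF i h(1)]] by auto
  moreover have "adj T (T h) = c i *\<^sub>C h"
    using gram[of h] sum_eq_single[OF i, of "\<lambda>l. c l *\<^sub>C P l h"] by (simp add: P_other[OF i _ _ h(1)] P_id[OF i h(1)])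
  ultimately obtain r where "r > 0" "c i = complex_of_real r"
    using adj_self_eigenvalue_pos[OF is_op_bclinear[OF T]] by blast
  then show ?thesis by auto
next
  case False
  then have "P i x = 0" for x using P_in[OF i, of x] by blast
  then show ?thesis by (intro exI[of _ 1]) simp
qed

lemma inverse_gram_diag:
  assumes T: "is_op S S T" and R: "is_op S S R"
    and RT: "\<And>x. R (T x) = proj S x" and TR: "\<And>x. T (R x) = proj S x"
    and gram: "\<And>x. adj T (T x) = diag (\<lambda>i. \<alpha> i * \<alpha> i) x" and inv: "diag (\<lambda>i. \<beta> i * \<alpha> i) = proj S"
  shows "R (adj R z) = diag (\<lambda>i. \<beta> i * \<beta> i) z"
proof -
  have adjTR: "adj T (adj R y) = proj S y" for y
    using adj_comp'[OF is_op_bclinear[OF R] is_op_bclinear[OF T]] RT adj_proj[OF csubspace_S]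
    by (metis (no_types, lifting) ext)
  have RadjT: "diag (\<lambda>i. \<beta> i * \<beta> i) (adj T y) = R y" for y
  proof -
    have "adj T y = adj T (T (R y))"
      using is_op_right[OF is_op_adj[OF T csubspace_S csubspace_S] csubspace_S, of y] by (simp add: TR)
    then have "diag (\<lambda>i. \<beta> i * \<beta> i) (adj T y) = diag (\<lambda>i. \<beta> i * \<alpha> i) (diag (\<lambda>i. \<beta> i * \<alpha> i) (R y))"
      by (simp add: gram diag_diag algebra_simps)
    also have "\<dots> = R y" using is_op_range[OF R csubspace_S] by (simp add: inv proj_id)
    finally show ?thesis .
  qed
  show ?thesis
    using RadjT[of "adj R z"] diag_diag[of "\<lambda>i. \<beta> i * \<beta> i" "\<lambda>_. 1" z] by (simp add: adjTR diag_one)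
qed

text \<open>With T* \<psi>(a) T = D \<Phi>(a) D for the positive diagonal operator D = diag \<alpha>, the operator
  U = D T\<inverse> is unitary: U* U = (T\<inverse>)* T* T T\<inverse> and U U* = D (T* T)\<inverse> D = 1.\<close>

lemma diagonal_conjugation_unitary:
  fixes \<psi> :: "'a \<Rightarrow> 'h \<Rightarrow> 'h"
  assumes T: "is_op S S T" and R: "is_op S S R"
    and RT: "\<And>x. R (T x) = proj S x" and TR: "\<And>x. T (R x) = proj S x"
    and \<psi>: "\<And>a. is_op S S (\<psi> a)" "\<psi> 1 = proj S" and r: "\<And>i. i < n \<Longrightarrow> r i > 0"
    and dec: "\<And>a x. adj T (\<psi> a (T x)) = (\<Sum>i<n. complex_of_real (r i) *\<^sub>C \<phi> i a x)"
  shows "\<exists>U. unitary_op S U \<and> (\<forall>a. \<psi> a = adj U \<circ> Phi a \<circ> U)"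
proof -
  have Tb: "bclinear T" and Rb: "bclinear R" using T R by (auto intro: is_op_bclinear)
  define \<alpha> where "\<alpha> i = complex_of_real (sqrt (r i))" for i
  define \<beta> where "\<beta> i = complex_of_real (1 / sqrt (r i))" for i
  have \<alpha>\<alpha>: "\<alpha> i * \<alpha> i = complex_of_real (r i)" and \<alpha>\<beta>: "\<alpha> i * \<beta> i = 1" if "i < n" for i
    using r[OF that] by (simp_all add: \<alpha>_def \<beta>_def of_real_mult[symmetric])
  have D: "diag \<alpha> (Phi a (diag \<alpha> x)) = adj T (\<psi> a (T x))" for a x
    by (simp add: diag_Phi_diag dec \<alpha>\<alpha>)
  have gram: "adj T (T x) = diag (\<lambda>i. \<alpha> i * \<alpha> i) x" for x
  proof -
    have "adj T (T x) = adj T (\<psi> 1 (T x))"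
      using \<psi>(2) is_op_range[OF T csubspace_S] by (simp add: proj_id)
    also have "\<dots> = diag (\<lambda>i. \<alpha> i * \<alpha> i) x"
      unfolding dec diag_def by (intro sum.cong refl) (simp add: \<phi>_one \<alpha>\<alpha>)
    finally show ?thesis .
  qed
  have inv: "diag (\<lambda>i. \<alpha> i * \<beta> i) = proj S" "diag (\<lambda>i. \<beta> i * \<alpha> i) = proj S"
    using diag_cong[of "\<lambda>i. \<alpha> i * \<beta> i" "\<lambda>_. 1"] diag_cong[of "\<lambda>i. \<beta> i * \<alpha> i" "\<lambda>_. 1"] \<alpha>\<beta>
    by (auto simp: fun_eq_iff diag_one mult.commute)
  have adjR: "adj R (adj T y) = proj S y" for y
    using adj_comp'[OF Tb Rb] TR adj_proj[OF csubspace_S] by (metis (no_types, lifting) ext)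
  define U where "U x = diag \<alpha> (R x)" for x
  have Uop: "is_op S S U" unfolding U_def[abs_def] by (rule is_op_comp'[OF diag_op R csubspace_S csubspace_S])
  have "(\<lambda>i. cnj (\<alpha> i)) = \<alpha>" by (simp add: \<alpha>_def fun_eq_iff)
  then have adjU: "adj U y = adj R (diag \<alpha> y)" for y
    unfolding U_def[abs_def] by (simp add: adj_comp'[OF diag_bclinear Rb] adj_diag)
  have "\<psi> a x = adj U (Phi a (U x))" for a x
    using is_op_left[OF \<psi>(1) csubspace_S] is_op_right[OF \<psi>(1) csubspace_S]
    by (simp add: adjU U_def D adjR TR)
  moreover have "adj U (U x) = proj S x" for x
    by (simp add: adjU U_def diag_diag gram[symmetric] adjR TR proj_idem[OF csubspace_S])
  moreover have "U (adj U y) = proj S y" for y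
  proof -
    have "U (adj U y) = diag (\<lambda>i. \<alpha> i * \<beta> i) (diag (\<lambda>i. \<beta> i * \<alpha> i) y)"
      by (simp add: adjU U_def inverse_gram_diag[OF T R RT TR gram inv(2)] diag_diag algebra_simps)
    then show ?thesis by (simp add: inv proj_idem[OF csubspace_S])
  qed
  ultimately show ?thesis
    unfolding unitary_op_def using Uop by (intro exI[of _ U]) (auto simp: fun_eq_iff)
qed

end

locale disjoint_pure_blocks = orthogonal_blocks n H \<phi>
  for n :: nat and H :: "nat \<Rightarrow> 'h::chilbert set" and \<phi> :: "nat \<Rightarrow> 'a::cstar_algebra \<Rightarrow> 'h \<Rightarrow> 'h" +
  fixes K :: "nat \<Rightarrow> 'k::chilbert set" and \<pi> :: "nat \<Rightarrow> 'a \<Rightarrow> 'k \<Rightarrow> 'k" and V :: "nat \<Rightarrow> 'h \<Rightarrow> 'k"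
  assumes pure_block: "\<And>i. i < n \<Longrightarrow> pure_cp (H i) (\<phi> i)"
    and min_stinespring_block: "\<And>i. i < n \<Longrightarrow> min_stinespring (H i) (\<phi> i) (K i) (\<pi> i) (V i)"
    and disjoint_blocks: "\<And>i j. i < n \<Longrightarrow> j < n \<Longrightarrow> i \<noteq> j \<Longrightarrow> \<not> unitarily_equiv (K i) (\<pi> i) (K j) (\<pi> j)"
begin

lemma cp_below_Phi_diagonal:
  assumes cp\<theta>: "cp_map S \<theta>" and cpd: "cp_map S (\<lambda>a x. Phi a x - \<theta> a x)"
  shows "\<exists>c. \<forall>a x. \<theta> a x = (\<Sum>i<n. c i *\<^sub>C \<phi> i a x)"
proof -
  have "\<exists>c. \<forall>a. (\<lambda>x. P i (\<theta> a (P i x))) = (\<lambda>x. c *\<^sub>C \<phi> i a x)" if i: "i < n" for i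
  proof -
    have "cp_map (H i) (\<lambda>a x. \<phi> i a x - P i (\<theta> a (P i x)))"
      using cp_map_compress[OF cpd csubspace_block[OF i]]
      by (simp add: P_def[symmetric] bclinear_diff[OF P_bclinear[OF i]] Phi_P P_id \<phi>_in i)
    moreover have "cp_map (H i) (\<lambda>a x. P i (\<theta> a (P i x)))"
      unfolding P_def by (rule cp_map_compress[OF cp\<theta> csubspace_block[OF i]])
    ultimately show ?thesis using pure_block[OF i] unfolding pure_cp_def by blast
  qed
  then obtain c where c: "\<And>i a x. i < n \<Longrightarrow> P i (\<theta> a (P i x)) = c i *\<^sub>C \<phi> i a x"
    by metis
  have "cinner (P k h') (\<theta> a (P i h)) = 0" if "i < n" "k < n" "i \<noteq> k" for i k h h' a
    unfolding P_def
    by (rule disjoint_pure_cp_offdiag_eq_zero[OF csubspace_block csubspace_block pure_block pure_block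
          min_stinespring_block min_stinespring_block disjoint_blocks cp\<theta> cpd])
      (use that in \<open>auto simp: Phi_block\<close>)
  then have "\<theta> a x = (\<Sum>i<n. c i *\<^sub>C \<phi> i a x)" for a x
    by (intro block_decomposition cp_map_op[OF cp\<theta>] c) auto
  then show ?thesis by blast
qed

lemma decomposition_summand_unitarily_equiv:
  fixes m :: nat
  assumes \<psi>T: "\<And>l. l < m \<Longrightarrow> ucp_map S (\<psi> l) \<and> invertible_op S (T l)"
    and dec: "\<And>a x. Phi a x = (\<Sum>l<m. adj (T l) (\<psi> l a (T l x)))" and j: "j < m"
  shows "\<exists>U. unitary_op S U \<and> (\<forall>a. \<psi> j a = adj U \<circ> Phi a \<circ> U)"
proof -
  have cp\<psi>: "cp_map S (\<psi> l)" and \<psi>1: "\<psi> l 1 = proj S" and T: "is_op S S (T l)" if "l < m" for l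
    using \<psi>T[OF that] unfolding ucp_map_def invertible_op_def by blast+
  define \<theta> where "\<theta> l a x = adj (T l) (\<psi> l a (T l x))" for l a x
  have cp\<theta>: "cp_map S (\<theta> l)" if "l < m" for l
    unfolding \<theta>_def[abs_def]
    by (rule cp_map_conj[OF csubspace_S cp\<psi>[OF that] is_op_bclinear[OF T[OF that]] is_op_right[OF T[OF that] csubspace_S]])
  have "Phi a x - \<theta> j a x = (\<Sum>l\<in>{..<m} - {j}. \<theta> l a x)" for a x
  proof -
    have "Phi a x = (\<Sum>l<m. \<theta> l a x)" unfolding dec \<theta>_def ..
    also have "\<dots> = \<theta> j a x + (\<Sum>l\<in>{..<m} - {j}. \<theta> l a x)" using j by (simp add: sum.remove)
    finally show ?thesis by simp
  qed
  then have "cp_map S (\<lambda>a x. Phi a x - \<theta> j a x)"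
    using cp_map_sum[OF csubspace_S, of "{..<m} - {j}" \<theta>] cp\<theta> by simp
  then obtain c where c: "\<And>a x. \<theta> j a x = (\<Sum>i<n. c i *\<^sub>C \<phi> i a x)"
    using cp_below_Phi_diagonal[OF cp\<theta>[OF j]] by blast
  obtain R where R: "is_op S S R" "R \<circ> T j = proj S" "T j \<circ> R = proj S"
    using \<psi>T[OF j] unfolding invertible_op_def by blast
  have RT: "R (T j x) = proj S x" and TR: "T j (R x) = proj S x" for x
    using R(2,3) by (metis comp_apply)+
  have gram: "adj (T j) (T j x) = (\<Sum>i<n. c i *\<^sub>C P i x)" for x
    using c[of 1 x] \<psi>1[OF j] is_op_range[OF T[OF j] csubspace_S] by (simp add: \<theta>_def proj_id \<phi>_one)
  have "\<exists>r>0. \<forall>x. c i *\<^sub>C P i x = complex_of_real r *\<^sub>C P i x" if "i < n" for i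
    by (rule gram_diag_coeffs_pos[OF T[OF j] RT is_op_bclinear[OF R(1)] gram that])
  then obtain r where r: "\<And>i. i < n \<Longrightarrow> r i > 0"
    and cr: "\<And>i x. i < n \<Longrightarrow> c i *\<^sub>C P i x = complex_of_real (r i) *\<^sub>C P i x"
    by metis
  show ?thesis
  proof (rule diagonal_conjugation_unitary[where \<psi> = "\<psi> j",
        OF T[OF j] R(1) RT TR cp_map_op[OF cp\<psi>[OF j]] \<psi>1[OF j] r])
    show "adj (T j) (\<psi> j a (T j x)) = (\<Sum>i<n. complex_of_real (r i) *\<^sub>C \<phi> i a x)" for a x
    proof -
      have "c i *\<^sub>C \<phi> i a x = complex_of_real (r i) *\<^sub>C \<phi> i a x" if "i < n" for i
        using cr[OF that, of "\<phi> i a x"] by (simp add: P_id \<phi>_in that)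
      then show ?thesis using c[of a x] unfolding \<theta>_def by simp
    qed
  qed
qed

end

theorem proposition3p7:
  fixes G :: "('g, 'b) monoid_scheme"
    and \<tau> :: "'g \<Rightarrow> 'a::cstar_algebra \<Rightarrow> 'a"
    and n :: nat
    and H :: "nat \<Rightarrow> 'h::chilbert set"
    and \<phi> :: "nat \<Rightarrow> 'a \<Rightarrow> 'h \<Rightarrow> 'h"
    and K :: "nat \<Rightarrow> 'k::chilbert set"
    and \<pi> :: "nat \<Rightarrow> 'a \<Rightarrow> 'k \<Rightarrow> 'k"
    and V :: "nat \<Rightarrow> 'h \<Rightarrow> 'k"
  assumes "group G"
    and "cstar_action G \<tau>"
    and "\<forall>i<n. csubspace (H i)"
    and "\<forall>i<n. \<forall>j<n. i \<noteq> j \<longrightarrow> (\<forall>x\<in>H i. \<forall>y\<in>H j. cinner x y = 0)"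
    and "\<forall>i<n. ucp_inv G \<tau> (H i) (\<phi> i) \<and> pure_cp (H i) (\<phi> i)"
    and "\<forall>i<n. min_stinespring (H i) (\<phi> i) (K i) (\<pi> i) (V i)"
    and "\<forall>i<n. \<forall>j<n. i \<noteq> j \<longrightarrow> \<not> unitarily_equiv (K i) (\<pi> i) (K j) (\<pi> j)"
  shows "cstar_extreme G \<tau> {(\<Sum>i<n. x i) | x. \<forall>i<n. x i \<in> H i} (\<lambda>a y. \<Sum>i<n. \<phi> i a y)"
proof -
  interpret disjoint_pure_blocks n H \<phi> K \<pi> V
    by unfold_locales (use assms(3-7) in \<open>auto simp: ucp_inv_def\<close>)
  have S: "{(\<Sum>i<n. x i) | x. \<forall>i<n. x i \<in> H i} = S" and Phi: "(\<lambda>a y. \<Sum>i<n. \<phi> i a y) = Phi"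
    by (simp_all add: S_def Phi_def[abs_def])
  have "ucp_inv G \<tau> S Phi"
    by (rule ucp_inv_Phi) (use assms(5) in \<open>auto simp: ucp_inv_def\<close>)
  moreover have "\<exists>U. \<forall>j<m. unitary_op S (U j) \<and> (\<forall>a. \<psi> j a = adj (U j) \<circ> Phi a \<circ> U j)"
    if "\<forall>j<m. ucp_inv G \<tau> S (\<psi> j) \<and> invertible_op S (T j)"
      and "\<forall>a. Phi a = (\<lambda>x. \<Sum>j<m. adj (T j) (\<psi> j a (T j x)))"
    for m T and \<psi> :: "nat \<Rightarrow> 'a \<Rightarrow> 'h \<Rightarrow> 'h"
    using decomposition_summand_unitarily_equiv[of m \<psi> T] that
    by (metis (no_types, lifting) ucp_inv_def)
  ultimately show ?thesis unfolding S Phi cstar_extreme_def by blast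
qed

end
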